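(* Let $n\ge4$ be an integer and let $L,\mu,R,\varepsilon>0$. Assume $\kappa=L/\mu\ge2$ and $\varepsilon\le LR^2/4$. Then $$\mathfrak m^{\mathrm C}(\varepsilon,R,L,\mu)=\begin{cases}\Omega\big((n+n^{3/4}\sqrt\kappa)\log(1/\varepsilon)\big), & \kappa=\Omega(\sqrt n),\\ \Omega\left(n+\left(\dfrac{n}{1+(\log(\sqrt n/\kappa))_+}\right)\log(1/\varepsilon)\right), & \kappa=O(\sqrt n),\end{cases}$$ where $a_+=\max\{a,0\}$.
   Context: Norms are Euclidean. $\mathcal P_{\mathcal X}$ is Euclidean projection onto a closed convex set $\mathcal X$. Problem: $\min_{x\in\mathcal X}f(x)=\frac1n\sum_{i=1}^nf_i(x)$ with $\mathcal X\subseteq\mathbb R^d$ closed and convex. A family $\{f_i\}_{i=1}^n$ of differentiable functions is $L$-average smooth if $\frac1n\sum_i\|\nabla f_i(x_1)-\nabla f_i(x_2)\|^2\le L^2\|x_1-x_2\|^2$ for all $x_1,x_2$ in the domain. $f$ is $\mu$-strongly convex if $f-\frac\mu2\|\cdot\|^2$ is convex (for $\mu=0$: $f$ convex). PIFO algorithms. Fix an absolute constant $c_0>0$ (e.g. $c_0=2$). The oracle $h^{\mathrm{PIFO}}_{f_i}(x,\gamma)$, $\gamma>0$, returns $[f_i(x),\nabla f_i(x),\mathrm{prox}^\gamma_{f_i}(x)]$ with $\mathrm{prox}^\gamma_{f_i}(x)=\arg\min_{u\in\mathbb R^d}\{f_i(u)+\frac1{2\gamma}\|x-u\|^2\}$ (when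 $f_i$ is nonconvex, $\gamma$ must be such that the minimized function is convex in $u$). The oracle $h^{\mathrm{FO}}_f(x)$ returns $[f(x),\nabla f(x)]$. A PIFO algorithm $\mathcal A$ fixes a distribution $\mathcal D$ on $\{1,\dots,n\}$ and $0<q\le c_0/n$, starts at $x_0=0$ with $\mathcal H=\{x_0\}$, and at step $t=1,2,\dots$: (i) samples $i_t\sim\mathcal D$ and queries $h^{\mathrm{PIFO}}_{f_{i_t}}$; (ii) samples $a_t\sim\mathrm{Bernoulli}(q)$ and, if $a_t=1$, queries $h^{\mathrm{FO}}_f$ and adds $x_{t-1}$ to $\mathcal H$; (iii) chooses $\tilde x_t$ in the linear span of $x_0,\dots,x_{t-1}$, of $\mathrm{prox}^{\gamma_j}_{f_{i_j}}(x_l)$ and $\nabla f_{i_j}(x_l)$ for $l<j\le t$, and of $\nabla f(u)$ for $u\in\mathcal H$; (iv) sets $x_t=\mathcal P_{\mathcal X}(\tilde x_t)$; (v) outputs $x_t$ or continues with $t+1$. The pairs $(i_t,a_t)$, $t\ge1$, are mutually independent and $i_t$ is independent of $a_t$. $\mathscr A$ is the class of all PIFO algorithms. Complexity. $\mathcal F_{\mathrm C}(R,L,\mu)$ is the set of $f=\frac1n\sum_{i=1}^nf_i:\mathcal X\to\mathbb R$ (any dimension $d$) with $\mathrm{diam}(\mathcal X)\le2R$, $\{f_i\}$ $L$-average smooth and $f$ $\mu$-strongly convex. $T(\mathcal A,f,\varepsilon)=\inf\{T\in\mathbb N:\mathbb Ef(x_{\mathcal A,T})-\min_{x\in\mathcal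 X}f(x)<\varepsilon\}$, where $x_{\mathcal A,T}$ is the point obtained by $\mathcal A$ at time-step $T$. $\mathfrak m^{\mathrm C}(\varepsilon,R,L,\mu)=\inf_{\mathcal A\in\mathscr A}\sup_{f\in\mathcal F_{\mathrm C}(R,L,\mu)}T(\mathcal A,f,\varepsilon)$. Asymptotic notation. $\Omega(g)$ means at least $c\,g$ with an absolute constant $c>0$ not depending on any problem parameter ($c_0$ being a fixed constant). A case condition $\kappa=\Omega(\sqrt n)$ (resp. $O(\sqrt n)$) means $\kappa\ge c'\sqrt n$ (resp. $\kappa\le c'\sqrt n$) for an absolute constant $c'$. In lower bounds, $\log(1/\varepsilon)$ is shorthand for $\log(s/\varepsilon)$ where the scale $s>0$ may depend on the other parameters but not on $\varepsilon$. *)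

theory Defs
  imports "HOL-Probability.Probability"
begin

subsection \<open>Euclidean spaces of varying dimension\<close>

text \<open>
  The dimension is quantified inside the complexity measure, so it cannot be a type. The spaces
  \<open>\<real>\<^sup>d\<close> are realised as the nested coordinate subspaces of the inner product space of finitely
  supported real sequences; the subspace \<open>euclid d\<close> with the inherited inner product is
  Euclidean \<open>d\<close>-space.
\<close>

typedef fvec = "{x :: nat \<Rightarrow> real. finite {i. x i \<noteq> 0}}"
  morphisms coord Abs_fvec
  by (rule exI[of _ "\<lambda>_. 0"]) simp

setup_lifting type_definition_fvec

lemma finite_coord [simp]: "finite {i. coord x i \<noteq> 0}"
  using coord[of x] by simp

lemma fvec_eq_iff: "x = y \<longleftrightarrow> (\<forall>i. coord x i = coord y i)"
  by (metis coord_inject ext)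

instantiation fvec :: real_vector
begin

lift_definition zero_fvec :: fvec is "\<lambda>_. 0" by simp

lift_definition plus_fvec :: "fvec \<Rightarrow> fvec \<Rightarrow> fvec" is "\<lambda>x y i. x i + y i"
proof -
  fix x y :: "nat \<Rightarrow> real"
  assume "finite {i. x i \<noteq> 0}" "finite {i. y i \<noteq> 0}"
  then have "finite ({i. x i \<noteq> 0} \<union> {i. y i \<noteq> 0})" by simp
  then show "finite {i. x i + y i \<noteq> 0}" by (rule rev_finite_subset) auto
qed

lift_definition uminus_fvec :: "fvec \<Rightarrow> fvec" is "\<lambda>x i. - x i" by simp

lift_definition minus_fvec :: "fvec \<Rightarrow> fvec \<Rightarrow> fvec" is "\<lambda>x y i. x i - y i"
proof -
  fix x y :: "nat \<Rightarrow> real"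
  assume "finite {i. x i \<noteq> 0}" "finite {i. y i \<noteq> 0}"
  then have "finite ({i. x i \<noteq> 0} \<union> {i. y i \<noteq> 0})" by simp
  then show "finite {i. x i - y i \<noteq> 0}" by (rule rev_finite_subset) auto
qed

lift_definition scaleR_fvec :: "real \<Rightarrow> fvec \<Rightarrow> fvec" is "\<lambda>r x i. r * x i"
  by (erule rev_finite_subset) auto

instance
  by standard (transfer; simp add: algebra_simps fun_eq_iff)+

end

lemmas coord_simps [simp] =
  zero_fvec.rep_eq plus_fvec.rep_eq uminus_fvec.rep_eq minus_fvec.rep_eq scaleR_fvec.rep_eq

instantiation fvec :: real_inner
begin

definition inner_fvec :: "fvec \<Rightarrow> fvec \<Rightarrow> real" where
  "inner_fvec x y = (\<Sum>i | coord x i \<noteq> 0. coord x i * coord y i)"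

definition norm_fvec :: "fvec \<Rightarrow> real" where
  "norm_fvec x = sqrt (inner x x)"

definition dist_fvec :: "fvec \<Rightarrow> fvec \<Rightarrow> real" where
  "dist_fvec x y = norm (x - y)"

definition sgn_fvec :: "fvec \<Rightarrow> fvec" where
  "sgn_fvec x = x /\<^sub>R norm x"

definition uniformity_fvec :: "(fvec \<times> fvec) filter" where
  "uniformity_fvec = (INF e\<in>{0<..}. principal {(x, y). dist x y < e})"

definition open_fvec :: "fvec set \<Rightarrow> bool" where
  "open_fvec U \<longleftrightarrow> (\<forall>x\<in>U. \<forall>\<^sub>F (x', y) in uniformity. x' = x \<longrightarrow> y \<in> U)"

lemma inner_fvec_superset:
  assumes "finite I" "{i. coord x i \<noteq> 0} \<subseteq> I"
  shows "inner x y = (\<Sum>i\<in>I. coord x i * coord y i)"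
  unfolding inner_fvec_def using assms by (intro sum.mono_neutral_left) auto

instance
proof
  fix x y z :: fvec and r :: real
  let ?I = "{i. coord x i \<noteq> 0} \<union> {i. coord y i \<noteq> 0}"
  have I: "finite ?I" by simp
  show "inner x y = inner y x"
    by (subst (1 2) inner_fvec_superset[OF I]) (auto simp: mult.commute)
  show "inner (x + y) z = inner x z + inner y z"
    by (subst (1 2 3) inner_fvec_superset[OF I]) (auto simp: algebra_simps sum.distrib)
  show "inner (r *\<^sub>R x) y = r * inner x y"
    by (subst (1 2) inner_fvec_superset[OF I]) (auto simp: algebra_simps sum_distrib_left)
  show "0 \<le> inner x x"
    unfolding inner_fvec_def by (intro sum_nonneg) auto
  show "inner x x = 0 \<longleftrightarrow> x = 0"
    unfolding inner_fvec_def by (subst sum_nonneg_eq_0_iff) (auto simp: fvec_eq_iff)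
qed (simp_all add: norm_fvec_def dist_fvec_def sgn_fvec_def uniformity_fvec_def open_fvec_def)

end

definition euclid :: "nat \<Rightarrow> fvec set" where
  "euclid d = {x. \<forall>i\<ge>d. coord x i = 0}"


subsection \<open>Gradients, average smoothness, strong convexity\<close>

definition grad :: "nat \<Rightarrow> (fvec \<Rightarrow> real) \<Rightarrow> fvec \<Rightarrow> fvec" where
  "grad d h x =
     (THE g. g \<in> euclid d \<and> (h has_derivative (\<lambda>v. inner g v)) (at x within euclid d))"

definition average :: "nat \<Rightarrow> (nat \<Rightarrow> fvec \<Rightarrow> real) \<Rightarrow> fvec \<Rightarrow> real" where
  "average n F x = (\<Sum>i=1..n. F i x) / real n"

text \<open>
  The components are functions on all of \<open>\<real>\<^sup>d\<close>, since the proximal operator minimises over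
  \<open>\<real>\<^sup>d\<close>; average smoothness is accordingly required there.
\<close>

definition average_smooth :: "nat \<Rightarrow> nat \<Rightarrow> (nat \<Rightarrow> fvec \<Rightarrow> real) \<Rightarrow> real \<Rightarrow> bool" where
  "average_smooth d n F L \<longleftrightarrow>
     (\<forall>i\<in>{1..n}. F i differentiable_on euclid d) \<and>
     (\<forall>x\<in>euclid d. \<forall>y\<in>euclid d.
        (\<Sum>i=1..n. (norm (grad d (F i) x - grad d (F i) y))\<^sup>2) / real n \<le> L\<^sup>2 * (norm (x - y))\<^sup>2)"

definition strongly_convex_on :: "fvec set \<Rightarrow> (fvec \<Rightarrow> real) \<Rightarrow> real \<Rightarrow> bool" where
  "strongly_convex_on X f \<mu> \<longleftrightarrow> convex_on X (\<lambda>x. f x - \<mu> / 2 * (norm x)\<^sup>2)"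


subsection \<open>Problem instances\<close>

record problem =
  dimension :: nat
  feasible :: "fvec set"
  component :: "nat \<Rightarrow> fvec \<Rightarrow> real"

definition objective :: "nat \<Rightarrow> problem \<Rightarrow> fvec \<Rightarrow> real" where
  "objective n P = average n (component P)"

text \<open>
  Algorithms start at \<open>x\<^sub>0 = 0\<close> and the objective, as a function on the feasible set, is evaluated
  at every iterate; so the starting point is feasible.
\<close>

definition convex_class :: "nat \<Rightarrow> real \<Rightarrow> real \<Rightarrow> real \<Rightarrow> problem set" where
  "convex_class n R L \<mu> =
     {P. feasible P \<subseteq> euclid (dimension P) \<and> closed (feasible P) \<and> convex (feasible P) \<and>
         0 \<in> feasible P \<and> bounded (feasible P) \<and> diameter (feasible P) \<le> 2 * R \<and>
         average_smooth (dimension P) n (component P) L \<and>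
         strongly_convex_on (feasible P) (objective n P) \<mu>}"


subsection \<open>Oracles\<close>

definition prox_objective :: "(fvec \<Rightarrow> real) \<Rightarrow> real \<Rightarrow> fvec \<Rightarrow> fvec \<Rightarrow> real" where
  "prox_objective h \<gamma> x u = h u + (norm (x - u))\<^sup>2 / (2 * \<gamma>)"

text \<open>
  The proximal part of the answer is absent when \<open>\<gamma>\<close> is not permitted for \<open>h\<close>, i.e. when
  the minimised function is not convex or has no minimiser. In this way the class of algorithms
  does not depend on the class of problems.
\<close>

definition prox :: "nat \<Rightarrow> (fvec \<Rightarrow> real) \<Rightarrow> real \<Rightarrow> fvec \<Rightarrow> fvec option" where
  "prox d h \<gamma> x =
     (if convex_on (euclid d) (prox_objective h \<gamma> x) \<and>
         (\<exists>u. is_arg_min (prox_objective h \<gamma> x) (\<lambda>u. u \<in> euclid d) u)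
      then Some (arg_min_on (prox_objective h \<gamma> x) (euclid d)) else None)"

definition proj :: "fvec set \<Rightarrow> fvec \<Rightarrow> fvec" where
  "proj X x = arg_min_on (\<lambda>u. norm (x - u)) X"

type_synonym pifo_answer = "real \<times> fvec \<times> fvec option"
type_synonym fo_answer = "real \<times> fvec"

definition pifo_oracle :: "nat \<Rightarrow> (fvec \<Rightarrow> real) \<Rightarrow> fvec \<Rightarrow> real \<Rightarrow> pifo_answer" where
  "pifo_oracle d h x \<gamma> = (h x, grad d h x, prox d h \<gamma> x)"

definition fo_oracle :: "nat \<Rightarrow> (fvec \<Rightarrow> real) \<Rightarrow> fvec \<Rightarrow> fo_answer" where
  "fo_oracle d h x = (h x, grad d h x)"


subsection \<open>PIFO algorithms\<close>

text \<open>
  A transcript is everything an algorithm has seen. The \<open>j\<close>-th entry of \<open>pifo_answers\<close> lists the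
  answers of the oracle of the \<open>j\<close>-th sampled component, with parameter \<open>\<gamma>\<^sub>j\<close>, at
  \<open>x\<^sub>0, \<dots>, x\<^bsub>j-1\<^esub>\<close>; \<open>fo_answers\<close> lists the answers of the full oracle at the points of
  the snapshot collection \<open>H\<close>, the first of which is \<open>x\<^sub>0\<close>.
\<close>

record transcript =
  iterates :: "fvec list"
  draws :: "(nat \<times> bool) list"
  pifo_answers :: "pifo_answer list list"
  fo_answers :: "fo_answer list"

definition available :: "transcript \<Rightarrow> fvec set" where
  "available \<tau> =
     set (iterates \<tau>) \<union>
     (\<Union>(v, g, p) \<in> set (concat (pifo_answers \<tau>)). insert g (set_option p)) \<union>
     snd ` set (fo_answers \<tau>)"

text \<open>
  Both rules know the dimension and the feasible set. \<open>prox_param\<close> sees the transcript of the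
  previous steps and the sampled index; \<open>next_point\<close> also sees the answers of the current step and
  returns the point to be projected. All randomness is in the draws.
\<close>

record algorithm =
  index_distr :: "nat pmf"
  full_prob :: real
  prox_param :: "nat \<Rightarrow> fvec set \<Rightarrow> transcript \<Rightarrow> nat \<Rightarrow> real"
  next_point :: "nat \<Rightarrow> fvec set \<Rightarrow> transcript \<Rightarrow> fvec"

definition pifo_algorithms :: "real \<Rightarrow> nat \<Rightarrow> algorithm set" where
  "pifo_algorithms c0 n =
     {A. set_pmf (index_distr A) \<subseteq> {1..n} \<and>
         0 < full_prob A \<and> full_prob A \<le> 1 \<and> full_prob A \<le> c0 / real n \<and>
         (\<forall>d X \<tau> i. 0 < prox_param A d X \<tau> i) \<and>
         (\<forall>d X \<tau>. next_point A d X \<tau> \<in> span (available \<tau>))}"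

definition initial :: "nat \<Rightarrow> problem \<Rightarrow> transcript" where
  "initial n P = \<lparr>iterates = [0], draws = [], pifo_answers = [],
     fo_answers = [fo_oracle (dimension P) (objective n P) 0]\<rparr>"

definition step :: "nat \<Rightarrow> algorithm \<Rightarrow> problem \<Rightarrow> transcript \<Rightarrow> nat \<times> bool \<Rightarrow> transcript" where
  "step n A P \<tau> = (\<lambda>(i, a).
     let d = dimension P; X = feasible P;
         \<gamma> = prox_param A d X \<tau> i;
         \<tau>' = \<tau>\<lparr>
           draws := draws \<tau> @ [(i, a)],
           pifo_answers := pifo_answers \<tau> @
             [map (\<lambda>x. pifo_oracle d (component P i) x \<gamma>) (iterates \<tau>)],
           fo_answers := fo_answers \<tau> @
             (if a then [fo_oracle d (objective n P) (last (iterates \<tau>))] else [])\<rparr>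
     in \<tau>'\<lparr>iterates := iterates \<tau>' @ [proj X (next_point A d X \<tau>')]\<rparr>)"

definition point_at :: "nat \<Rightarrow> algorithm \<Rightarrow> problem \<Rightarrow> (nat \<times> bool) list \<Rightarrow> fvec" where
  "point_at n A P \<omega> = last (iterates (foldl (step n A P) (initial n P) \<omega>))"


subsection \<open>Complexity\<close>

definition expected_value :: "nat \<Rightarrow> algorithm \<Rightarrow> problem \<Rightarrow> nat \<Rightarrow> real" where
  "expected_value n A P T =
     measure_pmf.expectation
       (replicate_pmf T (pair_pmf (index_distr A) (bernoulli_pmf (full_prob A))))
       (\<lambda>\<omega>. objective n P (point_at n A P \<omega>))"

text \<open>On the problems of \<open>convex_class\<close> the infimum over the feasible set is a minimum.\<close>

definition steps_needed :: "nat \<Rightarrow> algorithm \<Rightarrow> problem \<Rightarrow> real \<Rightarrow> enat" where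
  "steps_needed n A P \<epsilon> =
     Inf (enat ` {T. expected_value n A P T - (INF x\<in>feasible P. objective n P x) < \<epsilon>})"

definition complexity :: "real \<Rightarrow> nat \<Rightarrow> real \<Rightarrow> real \<Rightarrow> real \<Rightarrow> real \<Rightarrow> enat" where
  "complexity c0 n \<epsilon> R L \<mu> =
     (INF A\<in>pifo_algorithms c0 n. SUP P\<in>convex_class n R L \<mu>. steps_needed n A P \<epsilon>)"

end

theory Submission
  imports Defs
begin

text \<open>
  Since the scale \<open>s\<close> may depend on everything but \<open>\<epsilon>\<close>, only the rate of linear convergence
  matters: it suffices to find \<open>S > 0\<close> such that every algorithm needs at least of the order of
  \<open>n / t * ln (S / \<epsilon>)\<close> steps, where \<open>t\<close> is of the order \<open>n\<^bsup>1/4\<^esup> / \<surd>\<kappa>\<close> in the first case and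
  \<open>1 + (ln (\<surd>n / \<kappa>))\<^sub>+\<close> in the second. The isolated term \<open>n\<close> is absorbed by the first
  case condition or by the choice of \<open>s\<close>.

  The hard problem is a quadratic function on a long path of coordinates,
  \<open>\<mu>/2 \<parallel>x\<parallel>\<^sup>2 - b x\<^sub>0 + \<theta>/2 \<Sum>\<^sub>j (x\<^sub>j - x\<^bsub>j+1\<^esub>)\<^sup>2\<close>, minimised over a ball. Its minimiser decays like
  \<open>exp (- t j)\<close>, where \<open>\<mu> = \<theta> * (exp t + exp (- t) - 2)\<close>
  (\<open>chain_grad_two_sided_geometric\<close>), so a point supported on the first \<open>k + 1\<close> coordinates has a gap of
  at least a constant times \<open>exp (- 2 t k)\<close> (\<open>chain_gap\<close>).

  The edges of the path are given alternately to two components \<open>p\<close> and \<open>q\<close> which the algorithm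
  samples with probability \<open>O(1/n)\<close>; the other components carry no edges. Linear spans, projections
  onto a centred ball, gradients and proximal operators then extend the support by at most one
  coordinate per step, and only if \<open>p\<close> or \<open>q\<close> is sampled or the full gradient is queried
  (\<open>explored_step\<close>). For the proximal operator the reason is that truncating a candidate just before an edge
  which the component does not own lowers the minimised function.

  So after \<open>T\<close> steps the gap is at least of the order of the expectation of \<open>exp (- 2 t N)\<close> with \<open>N\<close>
  the number of such draws, and by Jensen's inequality this is at least
  \<open>exp (- 2 t (3 + c0) T / n)\<close> (\<open>expectation_exp_hits_ge\<close>, \<open>hard_problem_exists\<close>).
  Average smoothness bounds \<open>\<theta>\<close> by a multiple of \<open>L / \<surd>n\<close>, hence requires
  \<open>exp t + exp (- t) - 2\<close> to be at least of the order \<open>\<surd>n / \<kappa>\<close>; the two values of \<open>t\<close> satisfy this.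
\<close>

section \<open>Vectors with prescribed coordinates\<close>

definition prefix_vec :: "nat \<Rightarrow> (nat \<Rightarrow> real) \<Rightarrow> fvec" where
  "prefix_vec d g = Abs_fvec (\<lambda>j. if j < d then g j else 0)"

definition unit_vec :: "nat \<Rightarrow> fvec" where
  "unit_vec i = prefix_vec (Suc i) (\<lambda>j. of_bool (j = i))"

definition truncate_vec :: "nat \<Rightarrow> fvec \<Rightarrow> fvec" where
  "truncate_vec m x = prefix_vec m (coord x)"

lemma coord_prefix_vec [simp]: "coord (prefix_vec d g) j = (if j < d then g j else 0)"
proof -
  have "{j. (if j < d then g j else 0) \<noteq> 0} \<subseteq> {..<d}" by (auto split: if_splits)
  then have "finite {j. (if j < d then g j else 0) \<noteq> 0}"
    by (rule finite_subset) simp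
  then have "coord (prefix_vec d g) = (\<lambda>j. if j < d then g j else 0)"
    unfolding prefix_vec_def by (intro Abs_fvec_inverse CollectI)
  then show ?thesis by simp
qed

lemma coord_unit_vec [simp]: "coord (unit_vec i) j = of_bool (j = i)"
  by (auto simp: unit_vec_def)

lemma coord_truncate_vec [simp]: "coord (truncate_vec m x) j = (if j < m then coord x j else 0)"
  by (simp add: truncate_vec_def)

lemma coord_sum: "coord (sum g A) j = (\<Sum>i\<in>A. coord (g i) j)"
  by (induction A rule: infinite_finite_induct) auto

lemma inner_euclid:
  assumes "x \<in> euclid d"
  shows "inner x y = (\<Sum>j<d. coord x j * coord y j)"
proof (rule inner_fvec_superset)
  show "{i. coord x i \<noteq> 0} \<subseteq> {..<d}"
  proof
    fix i assume "i \<in> {i. coord x i \<noteq> 0}"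
    then have "\<not> d \<le> i" using assms by (auto simp: euclid_def)
    then show "i \<in> {..<d}" by simp
  qed
qed simp

lemma inner_unit_vec [simp]: "inner (unit_vec i) x = coord x i"
proof -
  have "unit_vec i \<in> euclid (Suc i)" by (auto simp: euclid_def)
  then show ?thesis by (simp add: inner_euclid)
qed

lemma norm_euclid:
  assumes "x \<in> euclid d"
  shows "(norm x)\<^sup>2 = (\<Sum>j<d. (coord x j)\<^sup>2)"
  using inner_euclid[OF assms, of x] by (simp add: dot_square_norm power2_eq_square)

lemma coord_sq_le_norm_sq: "(coord x j)\<^sup>2 \<le> (norm x)\<^sup>2"
proof -
  have 1: "norm (unit_vec j) = 1" by (simp add: norm_eq_1)
  have "\<bar>coord x j\<bar> \<le> norm (unit_vec j) * norm x"
    using Cauchy_Schwarz_ineq2[of "unit_vec j" x] by simp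
  then show ?thesis using 1 by (metis abs_le_square_iff abs_norm_cancel mult_1)
qed

lemma ex_euclid: "\<exists>d. x \<in> euclid d"
proof -
  have "bdd_above {i. coord x i \<noteq> 0}" by (rule bdd_above_finite) simp
  then obtain d where d: "\<And>i. coord x i \<noteq> 0 \<Longrightarrow> i \<le> d" by (auto simp: bdd_above_def)
  have "coord x i = 0" if "i \<ge> Suc d" for i using d[of i] that by linarith
  then have "x \<in> euclid (Suc d)" by (simp add: euclid_def)
  then show ?thesis ..
qed

lemma norm_truncate_vec_split:
  "(norm x)\<^sup>2 = (norm (truncate_vec m x))\<^sup>2 + (norm (x - truncate_vec m x))\<^sup>2"
proof -
  obtain d where d: "x \<in> euclid d" using ex_euclid by blast
  then have "truncate_vec m x \<in> euclid d" "x - truncate_vec m x \<in> euclid d"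
    by (auto simp: euclid_def)
  then have "(norm (truncate_vec m x))\<^sup>2 + (norm (x - truncate_vec m x))\<^sup>2 = 
      (\<Sum>j<d. (coord (truncate_vec m x) j)\<^sup>2 + (coord (x - truncate_vec m x) j)\<^sup>2)"
    by (simp add: norm_euclid[of _ d] sum.distrib del: coord_truncate_vec coord_simps)
  also have "\<dots> = (\<Sum>j<d. (coord x j)\<^sup>2)"
    by (intro sum.cong) auto
  finally show ?thesis using norm_euclid[OF d] by simp
qed

lemma truncate_vec_in_euclid: "truncate_vec m x \<in> euclid m"
  by (auto simp: euclid_def)

lemma truncate_vec_id: "x \<in> euclid m \<Longrightarrow> truncate_vec m x = x"
  by (auto simp: euclid_def fvec_eq_iff)

lemma truncate_vec_diff: "truncate_vec m (x - y) = truncate_vec m x - truncate_vec m y"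
  by (auto simp: fvec_eq_iff)

lemma norm_truncate_vec_le: "norm (truncate_vec m x) \<le> norm x"
proof -
  have "(norm (truncate_vec m x))\<^sup>2 \<le> (norm x)\<^sup>2"
    using norm_truncate_vec_split[of x m] by simp
  then show ?thesis by (rule power2_le_imp_le) simp
qed

text \<open>
  This is why supports spread slowly: a minimiser of a function of \<open>u\<close> that contains the distance of
  \<open>u\<close> to \<open>x\<close> cannot have coordinates beyond the support of \<open>x\<close>, unless cutting them off raises the
  rest of the function.
\<close>

lemma norm_truncate_vec_less:
  assumes "x \<in> euclid m" "u \<notin> euclid m"
  shows "norm (x - truncate_vec m u) < norm (x - u)"
proof -
  have "truncate_vec m u \<noteq> u"
    using assms(2) truncate_vec_in_euclid[of m u] by auto
  then have pos: "0 < (norm (truncate_vec m u - u))\<^sup>2" by simp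
  have diff: "truncate_vec m (x - u) = x - truncate_vec m u"
    unfolding truncate_vec_diff truncate_vec_id[OF assms(1)] ..
  have "(x - u) - truncate_vec m (x - u) = truncate_vec m u - u"
    unfolding diff by simp
  then have "(norm (x - u))\<^sup>2 = (norm (x - truncate_vec m u))\<^sup>2 + (norm (truncate_vec m u - u))\<^sup>2"
    using norm_truncate_vec_split[of "x - u" m] unfolding diff by simp
  with pos have "(norm (x - truncate_vec m u))\<^sup>2 < (norm (x - u))\<^sup>2" by linarith
  then show ?thesis by (rule power_less_imp_less_base) simp
qed

lemma subspace_euclid: "subspace (euclid d)"
  by (auto simp: subspace_def euclid_def)

lemma closed_euclid: "closed (euclid d)"
proof -
  have "euclid d = (\<Inter>j\<in>{d..}. {x. inner (unit_vec j) x = 0})"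
    by (auto simp: euclid_def)
  moreover have "closed {x. inner (unit_vec j) x = 0}" for j
    by (intro closed_Collect_eq continuous_intros)
  ultimately show ?thesis by auto
qed

lemma euclid_mono: "d \<le> e \<Longrightarrow> euclid d \<subseteq> euclid e"
  by (auto simp: euclid_def)

lemma span_subset_euclid: "B \<subseteq> euclid d \<Longrightarrow> span B \<subseteq> euclid d"
  by (rule span_minimal[OF _ subspace_euclid])

section \<open>Gradients, and projections on balls\<close>

text \<open>
  A derivative within a subspace does not determine its values on directions leaving the subspace,
  which is why the gradient is required to lie in it. For two candidates, the line
  in the direction of their difference stays inside, and along it the derivative is unique.
\<close>

lemma grad_eqI:
  assumes x: "x \<in> euclid d" and g: "g \<in> euclid d"
    and D: "(h has_derivative (\<lambda>v. inner g v)) (at x within euclid d)"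
  shows "grad d h x = g"
  unfolding grad_def
proof (rule the_equality)
  show "g \<in> euclid d \<and> (h has_derivative (\<lambda>v. inner g v)) (at x within euclid d)"
    using g D by simp
next
  fix g' assume g': "g' \<in> euclid d \<and> (h has_derivative (\<lambda>v. inner g' v)) (at x within euclid d)"
  define v where "v = g' - g"
  have v: "v \<in> euclid d"
    unfolding v_def using g g' by (intro subspace_diff[OF subspace_euclid]) auto
  have line: "range (\<lambda>s. x + s *\<^sub>R v) \<subseteq> euclid d"
    using x v by (auto simp: euclid_def)
  have L: "((\<lambda>s::real. x + s *\<^sub>R v) has_derivative (\<lambda>s. s *\<^sub>R v)) (at 0)"
    by (auto intro!: derivative_eq_intros)
  have along: "((\<lambda>s. h (x + s *\<^sub>R v)) has_derivative (\<lambda>s. inner k (s *\<^sub>R v))) (at 0)"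
    if "(h has_derivative (\<lambda>v. inner k v)) (at x within euclid d)" for k
    by (rule has_derivative_in_compose[OF L])
      (use has_derivative_subset[OF that line] in simp)
  have "(\<lambda>s. inner g' (s *\<^sub>R v)) = (\<lambda>s. inner g (s *\<^sub>R v))"
    by (rule has_derivative_unique[OF along along]) (use D g' in simp_all)
  from fun_cong[OF this, of 1] have "inner g' v = inner g v" by simp
  then have "inner v v = 0" by (simp add: v_def inner_diff_left)
  then show "g' = g" by (simp add: v_def)
qed

lemma arg_min_on_attained:
  assumes "is_arg_min f (\<lambda>x. x \<in> S) u"
  shows "is_arg_min f (\<lambda>x. x \<in> S) (arg_min_on f S)"
  unfolding arg_min_on_def arg_min_def using assms by (rule someI)

text \<open>
  The projection is a choice among minimisers, so one minimiser has to be exhibited: the rescaled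
  point. It then need not be identified with the chosen one, since the support of any minimiser is
  controlled by truncation, under which the ball is stable.
\<close>

lemma proj_ball:
  assumes m: "x \<in> euclid m" and d: "x \<in> euclid d" and R: "0 \<le> R"
  shows "proj (cball 0 R \<inter> euclid d) x \<in> cball 0 R \<inter> euclid d \<inter> euclid m"
proof -
  let ?X = "cball 0 R \<inter> euclid d" and ?f = "\<lambda>u. norm (x - u)"
  define c where "c = (if norm x \<le> R then 1 else R / norm x)"
  have c: "c *\<^sub>R x \<in> ?X"
    using d R subspace_scale[OF subspace_euclid d] by (auto simp: c_def)
  have "\<not> norm (x - y) < norm (x - c *\<^sub>R x)" if "y \<in> ?X" for y
  proof (cases "norm x \<le> R")
    case False
    have "norm (x - c *\<^sub>R x) = \<bar>1 - c\<bar> * norm x"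
      by (metis norm_scaleR scaleR_left_diff_distrib scaleR_one)
    also have "\<dots> = norm x - R"
      using False R by (auto simp: c_def field_simps abs_if)
    also have "\<dots> \<le> norm x - norm y" using that by simp
    also have "\<dots> \<le> norm (x - y)" by (rule norm_triangle_ineq2)
    finally show ?thesis by simp
  qed (simp add: c_def)
  then have "is_arg_min ?f (\<lambda>u. u \<in> ?X) (c *\<^sub>R x)"
    using c by (auto simp: is_arg_min_def)
  then have P: "is_arg_min ?f (\<lambda>u. u \<in> ?X) (proj ?X x)"
    unfolding proj_def by (rule arg_min_on_attained)
  then have X: "proj ?X x \<in> ?X" by (simp add: is_arg_min_def)
  have "truncate_vec m (proj ?X x) \<in> ?X"
    using X norm_truncate_vec_le[of m "proj ?X x"] by (auto simp: euclid_def)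
  then have "\<not> norm (x - truncate_vec m (proj ?X x)) < norm (x - proj ?X x)"
    using P by (simp add: is_arg_min_def)
  then have "proj ?X x \<in> euclid m"
    using norm_truncate_vec_less[OF m, of "proj ?X x"] by argo
  then show ?thesis using X by blast
qed

section \<open>Quadratic functions on a chain\<close>

text \<open>
  The coordinates \<open>0, \<dots>, m\<close> are the vertices of a path whose edge from \<open>j\<close> to \<open>j + 1\<close> has
  weight \<open>w j\<close>: \<open>chain_energy\<close> is the Dirichlet form of this weighted path and \<open>chain_op\<close> its
  Laplacian. All the components and the objective of the hard problem are instances of
  \<open>chain_quad\<close> with the same \<open>m\<close>, \<open>\<mu>\<close>, \<open>b\<close>, and differ in the weights only.
\<close>

definition chain_energy :: "nat \<Rightarrow> (nat \<Rightarrow> real) \<Rightarrow> fvec \<Rightarrow> real" where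
  "chain_energy m w x = (\<Sum>j<m. w j * (coord x j - coord x (Suc j))\<^sup>2)"

definition chain_op :: "nat \<Rightarrow> (nat \<Rightarrow> real) \<Rightarrow> fvec \<Rightarrow> fvec" where
  "chain_op m w x =
     (\<Sum>j<m. (w j * (coord x j - coord x (Suc j))) *\<^sub>R (unit_vec j - unit_vec (Suc j)))"

definition chain_quad :: "nat \<Rightarrow> real \<Rightarrow> real \<Rightarrow> (nat \<Rightarrow> real) \<Rightarrow> fvec \<Rightarrow> real" where
  "chain_quad m \<mu> b w x = \<mu> / 2 * (norm x)\<^sup>2 - b * coord x 0 + chain_energy m w x / 2"

definition chain_grad :: "nat \<Rightarrow> real \<Rightarrow> real \<Rightarrow> (nat \<Rightarrow> real) \<Rightarrow> fvec \<Rightarrow> fvec" where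
  "chain_grad m \<mu> b w x = \<mu> *\<^sub>R x - b *\<^sub>R unit_vec 0 + chain_op m w x"

lemma inner_chain_op:
  "inner (chain_op m w x) v =
     (\<Sum>j<m. w j * (coord x j - coord x (Suc j)) * (coord v j - coord v (Suc j)))"
  by (simp add: chain_op_def inner_sum_left inner_diff_left)

lemma coord_chain_op:
  "coord (chain_op m w x) k =
     (if k < m then w k * (coord x k - coord x (Suc k)) else 0) -
     (if 0 < k \<and> k \<le> m then w (k - 1) * (coord x (k - 1) - coord x k) else 0)"
proof -
  have "coord (chain_op m w x) k =
      (\<Sum>j<m. if j = k then w k * (coord x k - coord x (Suc k)) else 0) -
      (\<Sum>j<m. if Suc j = k then w (k - 1) * (coord x (k - 1) - coord x k) else 0)"
    unfolding chain_op_def coord_sum sum_subtractf[symmetric]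
    by (intro sum.cong) auto
  moreover have "(\<Sum>j<m. if Suc j = k then c else 0) = (if 0 < k \<and> k \<le> m then c else 0)" for c :: real
    by (cases k) auto
  ultimately show ?thesis by simp
qed

lemma chain_energy_nonneg:
  assumes "\<And>j. 0 \<le> w j"
  shows "0 \<le> chain_energy m w x"
  unfolding chain_energy_def using assms by (intro sum_nonneg) simp

lemma chain_energy_le:
  assumes w: "\<And>j. 0 \<le> w j \<and> w j \<le> l"
  shows "chain_energy m w x \<le> 4 * l * (norm x)\<^sup>2"
proof -
  have sq: "(\<Sum>j<k. (coord x j)\<^sup>2) \<le> (norm x)\<^sup>2" for k
    using norm_euclid[OF truncate_vec_in_euclid[of k x]] norm_truncate_vec_split[of x k] by simp
  have l: "0 \<le> l" using w[of 0] by linarith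
  have "w j * (coord x j - coord x (Suc j))\<^sup>2 \<le> l * (2 * (coord x j)\<^sup>2 + 2 * (coord x (Suc j))\<^sup>2)" for j
  proof (rule mult_mono)
    have "0 \<le> (coord x j + coord x (Suc j))\<^sup>2" by simp
    then show "(coord x j - coord x (Suc j))\<^sup>2 \<le> 2 * (coord x j)\<^sup>2 + 2 * (coord x (Suc j))\<^sup>2"
      by (simp add: power2_eq_square algebra_simps)
  qed (use w l in auto)
  then have "chain_energy m w x \<le> (\<Sum>j<m. l * (2 * (coord x j)\<^sup>2 + 2 * (coord x (Suc j))\<^sup>2))"
    unfolding chain_energy_def by (rule sum_mono)
  also have "\<dots> = l * (2 * (\<Sum>j<m. (coord x j)\<^sup>2) + 2 * (\<Sum>j<m. (coord x (Suc j))\<^sup>2))"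
    by (simp only: sum_distrib_left[symmetric] sum.distrib)
  also have "\<dots> \<le> l * (2 * (norm x)\<^sup>2 + 2 * (norm x)\<^sup>2)"
  proof (intro mult_left_mono add_mono l)
    have "(\<Sum>j<m. (coord x (Suc j))\<^sup>2) \<le> (\<Sum>j<Suc m. (coord x j)\<^sup>2)"
      unfolding sum.lessThan_Suc_shift by simp
    then show "(\<Sum>j<m. (coord x (Suc j))\<^sup>2) \<le> (norm x)\<^sup>2" using sq[of "Suc m"] by linarith
  qed (use sq in auto)
  finally show ?thesis by simp
qed

text \<open>
  The Laplacian is positive semidefinite, so a bound on its form gives a bound on its norm, by the
  Cauchy--Schwarz inequality for the form; here in the additive version, applied to \<open>x\<close>
  and the image of \<open>x\<close> edge by edge.
\<close>

lemma norm_chain_op_le: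
  assumes w: "\<And>j. 0 \<le> w j \<and> w j \<le> l" and l: "0 < l"
  shows "(norm (chain_op m w x))\<^sup>2 \<le> 16 * l\<^sup>2 * (norm x)\<^sup>2"
proof -
  let ?v = "chain_op m w x"
  define a b where "a = (\<lambda>j. coord x j - coord x (Suc j))" and
    "b = (\<lambda>j. coord ?v j - coord ?v (Suc j))"
  have ab: "w j * a j * b j \<le> 2 * l * (w j * (a j)\<^sup>2) + (w j * (b j)\<^sup>2) / (8 * l)" for j
  proof -
    have "0 \<le> w j * (4 * l * a j - b j)\<^sup>2 / (8 * l)" using w[of j] l by simp
    also have "\<dots> = 2 * l * (w j * (a j)\<^sup>2) + (w j * (b j)\<^sup>2) / (8 * l) - w j * a j * b j"
      using l by (simp add: power2_eq_square field_simps)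
    finally show ?thesis by simp
  qed
  have "(norm ?v)\<^sup>2 = (\<Sum>j<m. w j * a j * b j)"
    using inner_chain_op[of m w x ?v] by (simp add: dot_square_norm a_def b_def)
  also have "\<dots> \<le> (\<Sum>j<m. 2 * l * (w j * (a j)\<^sup>2) + (w j * (b j)\<^sup>2) / (8 * l))"
    using ab by (rule sum_mono)
  also have "\<dots> = 2 * l * chain_energy m w x + chain_energy m w ?v / (8 * l)"
    by (simp add: chain_energy_def a_def b_def sum.distrib sum_distrib_left sum_divide_distrib)
  also have "\<dots> \<le> 2 * l * (4 * l * (norm x)\<^sup>2) + (4 * l * (norm ?v)\<^sup>2) / (8 * l)"
    using chain_energy_le[OF w] l by (intro add_mono mult_left_mono divide_right_mono) auto
  also have "\<dots> = 8 * l\<^sup>2 * (norm x)\<^sup>2 + (norm ?v)\<^sup>2 / 2"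
    using l by (simp add: power2_eq_square)
  finally show ?thesis by simp
qed

lemma chain_op_diff: "chain_op m w x - chain_op m w y = chain_op m w (x - y)"
  by (auto simp: fvec_eq_iff coord_chain_op algebra_simps)

lemma chain_grad_diff: "chain_grad m \<mu> b w x - chain_grad m \<mu> b w y = \<mu> *\<^sub>R (x - y) + chain_op m w (x - y)"
  by (simp add: chain_grad_def chain_op_diff[symmetric] algebra_simps)

lemma chain_quad_expand:
  "chain_quad m \<mu> b w y = chain_quad m \<mu> b w x + inner (chain_grad m \<mu> b w x) (y - x) +
     (\<mu> / 2 * (norm (y - x))\<^sup>2 + chain_energy m w (y - x) / 2)"
proof -
  have E: "chain_energy m w y = chain_energy m w x + 2 * inner (chain_op m w x) (y - x) +
      chain_energy m w (y - x)"
    unfolding chain_energy_def inner_chain_op sum_distrib_left sum.distrib[symmetric]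
    by (intro sum.cong refl) (simp add: power2_eq_square algebra_simps)
  have N: "(norm y)\<^sup>2 = (norm x)\<^sup>2 + 2 * inner x (y - x) + (norm (y - x))\<^sup>2"
    by (simp add: power2_norm_eq_inner inner_diff_left inner_diff_right inner_commute)
  show ?thesis
    unfolding chain_quad_def chain_grad_def E N
    by (simp add: inner_add_left inner_diff_left field_simps)
qed

lemma has_derivative_coord: "((\<lambda>x. coord x j) has_derivative (\<lambda>v. coord v j)) (at x within S)"
proof -
  have "((\<lambda>x. inner (unit_vec j) x) has_derivative (\<lambda>v. inner (unit_vec j) v)) (at x within S)"
    by (intro derivative_eq_intros) auto
  then show ?thesis by simp
qed

lemma has_derivative_chain_quad:
  "(chain_quad m \<mu> b w has_derivative (\<lambda>v. inner (chain_grad m \<mu> b w x) v)) (at x within S)"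
proof -
  have edge: "((\<lambda>y. w j * (coord y j - coord y (Suc j))\<^sup>2) has_derivative
      (\<lambda>v. 2 * (w j * (coord x j - coord x (Suc j)) * (coord v j - coord v (Suc j))))) (at x within S)" for j
    by (rule has_derivative_eq_rhs[OF has_derivative_mult_right[OF has_derivative_power[OF
          has_derivative_diff[OF has_derivative_coord has_derivative_coord]]]])
      (simp add: fun_eq_iff)
  have E: "(chain_energy m w has_derivative (\<lambda>v. 2 * inner (chain_op m w x) v)) (at x within S)"
    unfolding chain_energy_def[abs_def] inner_chain_op sum_distrib_left
    by (intro has_derivative_sum edge)
  have N: "((\<lambda>y. (norm y)\<^sup>2) has_derivative (\<lambda>v. 2 * inner x v)) (at x within S)"
    unfolding power2_norm_eq_inner
    by (auto intro!: derivative_eq_intros simp: inner_commute)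
  have "((\<lambda>y. \<mu> / 2 * (norm y)\<^sup>2 - b * coord y 0 + chain_energy m w y * (1 / 2)) has_derivative
      (\<lambda>v. \<mu> / 2 * (2 * inner x v) - b * coord v 0 + 2 * inner (chain_op m w x) v * (1 / 2))) (at x within S)"
    by (intro has_derivative_add has_derivative_diff has_derivative_mult_right has_derivative_mult_left
        has_derivative_coord E N)
  then show ?thesis
    by (simp add: chain_quad_def[abs_def] chain_grad_def inner_add_left inner_diff_left)
qed

lemma grad_chain_quad:
  assumes "x \<in> euclid (Suc m)"
  shows "grad (Suc m) (chain_quad m \<mu> b w) x = chain_grad m \<mu> b w x"
proof (rule grad_eqI[OF assms _ has_derivative_chain_quad])
  show "chain_grad m \<mu> b w x \<in> euclid (Suc m)"
    using assms by (auto simp: euclid_def chain_grad_def coord_chain_op)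
qed

lemma convex_on_chain_energy:
  assumes "\<And>j. 0 \<le> w j" "convex S"
  shows "convex_on S (\<lambda>x. chain_energy m w x / 2 - b * coord x 0)"
proof (rule convex_onI[OF _ assms(2)])
  fix t :: real and x y :: fvec assume t: "0 < t" "t < 1"
  have q: "chain_energy m w z / 2 - b * coord z 0 = chain_quad m 0 b w z" for z
    by (simp add: chain_quad_def)
  let ?z = "(1 - t) *\<^sub>R x + t *\<^sub>R y"
  have z: "x - ?z = t *\<^sub>R (x - y)" "y - ?z = - (1 - t) *\<^sub>R (x - y)"
    by (auto simp: algebra_simps)
  have le: "chain_quad m 0 b w ?z + inner (chain_grad m 0 b w ?z) (u - ?z) \<le> chain_quad m 0 b w u" for u
    using chain_quad_expand[of m 0 b w u ?z] chain_energy_nonneg[OF assms(1)] by simp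
  have "chain_quad m 0 b w ?z =
      (1 - t) * (chain_quad m 0 b w ?z + inner (chain_grad m 0 b w ?z) (x - ?z)) +
      t * (chain_quad m 0 b w ?z + inner (chain_grad m 0 b w ?z) (y - ?z))"
    unfolding z by (simp add: algebra_simps)
  also have "\<dots> \<le> (1 - t) * chain_quad m 0 b w x + t * chain_quad m 0 b w y"
    using t by (intro add_mono mult_left_mono le) auto
  finally show "chain_energy m w ?z / 2 - b * coord ?z 0 \<le>
      (1 - t) * (chain_energy m w x / 2 - b * coord x 0) + t * (chain_energy m w y / 2 - b * coord y 0)"
    by (simp only: q)
qed

lemma chain_grad_in_euclid:
  assumes "x \<in> euclid (Suc k)"
  shows "chain_grad m \<mu> b w x \<in> euclid (Suc (Suc k))"
  using assms by (auto simp: euclid_def chain_grad_def coord_chain_op)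

text \<open>
  An edge of weight zero cuts the path: neither the gradient nor the proximal operator carries
  information across it.
\<close>

lemma chain_grad_in_euclid_cut:
  assumes "x \<in> euclid (Suc k)" "w k = 0"
  shows "chain_grad m \<mu> b w x \<in> euclid (Suc k)"
proof -
  have "coord (chain_grad m \<mu> b w x) j = 0" if "j \<ge> Suc k" for j
    using assms that by (cases "j = Suc k") (auto simp: euclid_def chain_grad_def coord_chain_op)
  then show ?thesis by (simp add: euclid_def)
qed

lemma chain_quad_truncate_le:
  assumes "\<And>j. 0 \<le> w j" "w k = 0" "0 \<le> \<mu>"
  shows "chain_quad m \<mu> b w (truncate_vec (Suc k) u) \<le> chain_quad m \<mu> b w u"
proof -
  have "chain_energy m w (truncate_vec (Suc k) u) \<le> chain_energy m w u"
    unfolding chain_energy_def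
  proof (rule sum_mono)
    fix j
    show "w j * (coord (truncate_vec (Suc k) u) j - coord (truncate_vec (Suc k) u) (Suc j))\<^sup>2
        \<le> w j * (coord u j - coord u (Suc j))\<^sup>2"
      using assms(1)[of j] assms(2) by (cases "j = k") auto
  qed
  moreover have "(norm (truncate_vec (Suc k) u))\<^sup>2 \<le> (norm u)\<^sup>2"
    using norm_truncate_vec_le by (intro power_mono) auto
  then have "\<mu> / 2 * (norm (truncate_vec (Suc k) u))\<^sup>2 \<le> \<mu> / 2 * (norm u)\<^sup>2"
    using assms(3) by (intro mult_left_mono) auto
  ultimately show ?thesis by (simp add: chain_quad_def)
qed

lemma prox_chain_quad:
  assumes w: "\<And>j. 0 \<le> w j" "w k = 0" and \<mu>: "0 \<le> \<mu>" and \<gamma>: "0 < \<gamma>"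
    and x: "x \<in> euclid (Suc k)" and p: "prox d (chain_quad m \<mu> b w) \<gamma> x = Some p"
  shows "p \<in> euclid (Suc k)"
proof (rule ccontr)
  let ?f = "prox_objective (chain_quad m \<mu> b w) \<gamma> x"
  assume out: "p \<notin> euclid (Suc k)"
  have "is_arg_min ?f (\<lambda>u. u \<in> euclid d) p"
    using p arg_min_on_attained unfolding prox_def by (auto split: if_splits)
  then have p: "p \<in> euclid d" "\<And>u. u \<in> euclid d \<Longrightarrow> \<not> ?f u < ?f p"
    by (auto simp: is_arg_min_def)
  have "truncate_vec (Suc k) p \<in> euclid d" using p(1) by (auto simp: euclid_def)
  then have "\<not> ?f (truncate_vec (Suc k) p) < ?f p" by (rule p(2))
  moreover have "(norm (x - truncate_vec (Suc k) p))\<^sup>2 / (2 * \<gamma>) < (norm (x - p))\<^sup>2 / (2 * \<gamma>)"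
    using norm_truncate_vec_less[OF x out] \<gamma> by (intro divide_strict_right_mono power_strict_mono) auto
  ultimately show False
    using chain_quad_truncate_le[of w k \<mu> m b p] w \<mu> unfolding prox_objective_def by fastforce
qed

section \<open>Splitting the chain between two components\<close>

text \<open>
  The even edges belong to the component \<open>p\<close> and the odd edges to the component \<open>q\<close>. A
  component thus never owns two adjacent edges, so that its proximal operator, unlike that of the
  whole chain, crosses at most one edge.
\<close>

definition edge_weight :: "nat \<Rightarrow> nat \<Rightarrow> real \<Rightarrow> nat \<Rightarrow> nat \<Rightarrow> real" where
  "edge_weight p q l i j = (if i = (if even j then p else q) then l else 0)"

definition chain_problem :: "nat \<Rightarrow> real \<Rightarrow> real \<Rightarrow> real \<Rightarrow> real \<Rightarrow> nat \<Rightarrow> nat \<Rightarrow> problem" where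
  "chain_problem m \<mu> b l R p q =
     \<lparr>dimension = Suc m, feasible = cball 0 R \<inter> euclid (Suc m),
      component = (\<lambda>i. chain_quad m \<mu> b (edge_weight p q l i))\<rparr>"

lemma chain_problem_simps [simp]:
  "dimension (chain_problem m \<mu> b l R p q) = Suc m"
  "feasible (chain_problem m \<mu> b l R p q) = cball 0 R \<inter> euclid (Suc m)"
  "component (chain_problem m \<mu> b l R p q) i = chain_quad m \<mu> b (edge_weight p q l i)"
  by (simp_all add: chain_problem_def)

lemma objective_chain_problem:
  assumes "p \<in> {1..n}" "q \<in> {1..n}"
  shows "objective n (chain_problem m \<mu> b l R p q) = chain_quad m \<mu> b (\<lambda>_. l / real n)"
proof
  fix x
  have n: "n > 0" using assms by auto
  have "(\<Sum>i=1..n. edge_weight p q l i j) = l" for j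
    unfolding edge_weight_def using assms by (subst sum.delta) auto
  then have E: "(\<Sum>i=1..n. chain_energy m (edge_weight p q l i) x) = chain_energy m (\<lambda>_. l) x"
    unfolding chain_energy_def
    by (subst sum.swap) (simp add: sum_distrib_right[symmetric])
  have E': "chain_energy m (\<lambda>_. l / real n) x = chain_energy m (\<lambda>_. l) x / real n"
    by (simp add: chain_energy_def sum_divide_distrib)
  have total: "(\<Sum>i=1..n. c + chain_energy m (edge_weight p q l i) x / 2) =
      real n * c + chain_energy m (\<lambda>_. l) x / 2" for c
    by (simp add: sum.distrib sum_divide_distrib[symmetric] E[simplified])
  show "objective n (chain_problem m \<mu> b l R p q) x = chain_quad m \<mu> b (\<lambda>_. l / real n) x"
    unfolding objective_def average_def chain_quad_def chain_problem_simps E' total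
    using n by (simp add: field_simps)
qed

text \<open>
  Only two of the \<open>n\<close> components have edges, so the edge weight enters the average of the squared
  norms as \<open>l\<^sup>2 / n\<close>. This permits \<open>l\<close> of the order \<open>L * sqrt n\<close>, which is where the powers of
  \<open>n\<close> in the bound come from.
\<close>

lemma average_smooth_chain:
  assumes n: "p \<in> {1..n}" "q \<in> {1..n}" "p \<noteq> q" and l: "0 < l"
    and L: "\<mu>\<^sup>2 * (1 + 2 / real n) + 64 * l\<^sup>2 / real n \<le> L\<^sup>2"
  shows "average_smooth (Suc m) n (\<lambda>i. chain_quad m \<mu> b (edge_weight p q l i)) L"
  unfolding average_smooth_def
proof (intro conjI ballI)
  fix i show "chain_quad m \<mu> b (edge_weight p q l i) differentiable_on euclid (Suc m)"
    unfolding differentiable_on_def differentiable_def using has_derivative_chain_quad by blast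
next
  fix x y assume xy: "x \<in> euclid (Suc m)" "y \<in> euclid (Suc m)"
  define z where "z = x - y"
  define K where "K = (\<mu>\<^sup>2 + 32 * l\<^sup>2) * (norm z)\<^sup>2"
  let ?g = "\<lambda>i. grad (Suc m) (chain_quad m \<mu> b (edge_weight p q l i))"
  have "(norm (?g i x - ?g i y))\<^sup>2 \<le>
      \<mu>\<^sup>2 * (norm z)\<^sup>2 + ((if i = p then K else 0) + (if i = q then K else 0))" for i
  proof -
    define v where "v = chain_op m (edge_weight p q l i) z"
    have eq: "?g i x - ?g i y = \<mu> *\<^sub>R z + v"
      using xy by (simp add: grad_chain_quad chain_grad_diff z_def v_def)
    show ?thesis
    proof (cases "i = p \<or> i = q")
      case True
      have v: "(norm v)\<^sup>2 \<le> 16 * l\<^sup>2 * (norm z)\<^sup>2"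
        unfolding v_def using l by (intro norm_chain_op_le) (auto simp: edge_weight_def)
      have "norm (\<mu> *\<^sub>R z + v) \<le> \<bar>\<mu>\<bar> * norm z + norm v"
        using norm_triangle_ineq[of "\<mu> *\<^sub>R z" v] by simp
      then have "(norm (\<mu> *\<^sub>R z + v))\<^sup>2 \<le> (\<bar>\<mu>\<bar> * norm z + norm v)\<^sup>2"
        by (intro power_mono) auto
      also have "\<dots> \<le> 2 * (\<bar>\<mu>\<bar> * norm z)\<^sup>2 + 2 * (norm v)\<^sup>2"
        using sum_squares_bound[of "\<bar>\<mu>\<bar> * norm z" "norm v"]
        by (simp add: power2_sum)
      also have "\<dots> \<le> 2 * (\<mu>\<^sup>2 * (norm z)\<^sup>2) + 2 * (16 * l\<^sup>2 * (norm z)\<^sup>2)"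
        using v by (simp add: power_mult_distrib)
      also have "\<dots> = \<mu>\<^sup>2 * (norm z)\<^sup>2 + K" by (simp add: K_def algebra_simps)
      finally show ?thesis using True n by (auto simp: eq)
    next
      case False
      then have "edge_weight p q l i j = 0" for j by (simp add: edge_weight_def)
      then have "v = 0" by (simp add: v_def chain_op_def)
      then show ?thesis using False by (simp add: eq power_mult_distrib)
    qed
  qed
  then have "(\<Sum>i=1..n. (norm (?g i x - ?g i y))\<^sup>2) \<le>
      (\<Sum>i=1..n. \<mu>\<^sup>2 * (norm z)\<^sup>2 + ((if i = p then K else 0) + (if i = q then K else 0)))"
    by (rule sum_mono)
  also have "\<dots> = real n * (\<mu>\<^sup>2 * (norm z)\<^sup>2) + 2 * K"
    using n by (simp add: sum.distrib)
  finally have "(\<Sum>i=1..n. (norm (?g i x - ?g i y))\<^sup>2) / real n \<le>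
      (real n * (\<mu>\<^sup>2 * (norm z)\<^sup>2) + 2 * K) / real n"
    by (rule divide_right_mono) simp
  also have "\<dots> = (\<mu>\<^sup>2 * (1 + 2 / real n) + 64 * l\<^sup>2 / real n) * (norm z)\<^sup>2"
    using n by (simp add: K_def field_simps)
  also have "\<dots> \<le> L\<^sup>2 * (norm z)\<^sup>2" using L by (rule mult_right_mono) simp
  finally show "(\<Sum>i=1..n. (norm (?g i x - ?g i y))\<^sup>2) / real n \<le> L\<^sup>2 * (norm (x - y))\<^sup>2"
    by (simp add: z_def)
qed

lemma chain_problem_in_convex_class:
  assumes n: "p \<in> {1..n}" "q \<in> {1..n}" "p \<noteq> q" and l: "0 < l" and R: "0 \<le> R"
    and L: "\<mu>\<^sup>2 * (1 + 2 / real n) + 64 * l\<^sup>2 / real n \<le> L\<^sup>2"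
  shows "chain_problem m \<mu> b l R p q \<in> convex_class n R L \<mu>"
proof -
  let ?X = "cball 0 R \<inter> euclid (Suc m)"
  have cvx: "convex ?X"
    by (intro convex_Int convex_cball subspace_imp_convex subspace_euclid)
  have "diameter ?X \<le> 2 * R"
  proof (rule diameter_le)
    fix x y assume "x \<in> ?X" "y \<in> ?X"
    then show "norm (x - y) \<le> 2 * R" using norm_triangle_ineq4[of x y] by simp
  qed (use R in simp)
  moreover have "strongly_convex_on ?X (chain_quad m \<mu> b (\<lambda>_. l / real n)) \<mu>"
  proof -
    have "(\<lambda>x. chain_quad m \<mu> b (\<lambda>_. l / real n) x - \<mu> / 2 * (norm x)\<^sup>2) =
        (\<lambda>x. chain_energy m (\<lambda>_. l / real n) x / 2 - b * coord x 0)"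
      by (simp add: chain_quad_def fun_eq_iff)
    then show ?thesis
      unfolding strongly_convex_on_def using convex_on_chain_energy[OF _ cvx] l by simp
  qed
  moreover have "0 \<in> ?X" using R subspace_0[OF subspace_euclid] by simp
  moreover have "component (chain_problem m \<mu> b l R p q) =
      (\<lambda>i. chain_quad m \<mu> b (edge_weight p q l i))"
    by (simp add: fun_eq_iff)
  ultimately show ?thesis
    unfolding convex_class_def
    using n l L cvx closed_Int[OF closed_cball closed_euclid]
    by (simp add: objective_chain_problem average_smooth_chain bounded_Int)
qed

section \<open>Spread of the support\<close>

text \<open>
  The draws that may extend the support of the iterates: one of the two components with edges is
  sampled, or the full gradient is queried.
\<close>

definition hit :: "nat \<Rightarrow> nat \<Rightarrow> nat \<times> bool \<Rightarrow> bool" where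
  "hit p q = (\<lambda>(i, a). i = p \<or> i = q \<or> a)"

definition explored :: "nat \<Rightarrow> nat \<Rightarrow> transcript \<Rightarrow> bool" where
  "explored m k \<tau> \<longleftrightarrow> iterates \<tau> \<noteq> [] \<and> available \<tau> \<subseteq> euclid (Suc k) \<inter> euclid (Suc m)"

lemma pifo_answer_in_euclid:
  assumes w: "\<And>j. 0 \<le> w j" "w k = 0" and \<mu>: "0 \<le> \<mu>" and \<gamma>: "0 < \<gamma>"
    and x: "x \<in> euclid (Suc k) \<inter> euclid (Suc m)"
    and o: "pifo_oracle (Suc m) (chain_quad m \<mu> b w) x \<gamma> = (v, g, r)"
  shows "insert g (set_option r) \<subseteq> euclid (Suc k) \<inter> euclid (Suc m)"
proof -
  have g: "g = chain_grad m \<mu> b w x"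
    using o x by (simp add: pifo_oracle_def grad_chain_quad)
  have "chain_grad m \<mu> b w x \<in> euclid (Suc m)"
    using x by (auto simp: euclid_def chain_grad_def coord_chain_op)
  then have "g \<in> euclid (Suc k) \<inter> euclid (Suc m)"
    using chain_grad_in_euclid_cut[of x k w m \<mu> b] x w g by auto
  moreover have "u \<in> euclid (Suc k) \<inter> euclid (Suc m)" if "r = Some u" for u
  proof -
    have u: "prox (Suc m) (chain_quad m \<mu> b w) \<gamma> x = Some u"
      using o that by (simp add: pifo_oracle_def)
    then have "is_arg_min (prox_objective (chain_quad m \<mu> b w) \<gamma> x) (\<lambda>u. u \<in> euclid (Suc m)) u"
      using arg_min_on_attained unfolding prox_def by (auto split: if_splits)
    then have "u \<in> euclid (Suc m)" by (simp add: is_arg_min_def)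
    then show ?thesis using prox_chain_quad[OF w \<mu> \<gamma> _ u] x by auto
  qed
  ultimately show ?thesis by (cases r) auto
qed

text \<open>
  All queries of a step are made at earlier iterates, whose support ends at coordinate \<open>k\<close>. If the
  sampled component owns the edge leaving \<open>k\<close>, it does not own the next one, so its answers
  end at \<open>k + 1\<close>; otherwise they end at \<open>k\<close>. The full gradient also crosses one edge only, and
  since both kinds of answers in a step are evaluated at the old points, their effects do not
  accumulate.
\<close>

lemma explored_step:
  assumes n: "p \<in> {1..n}" "q \<in> {1..n}" "p \<noteq> q" and l: "0 < l" and R: "0 \<le> R" and \<mu>: "0 \<le> \<mu>"
    and A: "A \<in> pifo_algorithms c0 n" and \<tau>: "explored m k \<tau>"
  shows "explored m (if hit p q s then Suc k else k) (step n A (chain_problem m \<mu> b l R p q) \<tau> s)"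
proof -
  obtain i a where s: "s = (i, a)" by fastforce
  define k' where "k' = (if hit p q s then Suc k else k)"
  define E where "E = (\<lambda>k. euclid (Suc k) \<inter> euclid (Suc m))"
  let ?P = "chain_problem m \<mu> b l R p q" and ?X = "cball 0 R \<inter> euclid (Suc m)"
  define w where "w = edge_weight p q l i"
  define \<gamma> where "\<gamma> = prox_param A (Suc m) ?X \<tau> i"
  define ans where "ans = map (\<lambda>x. pifo_oracle (Suc m) (chain_quad m \<mu> b w) x \<gamma>) (iterates \<tau>)"
  define fo where
    "fo = (if a then [fo_oracle (Suc m) (objective n ?P) (last (iterates \<tau>))] else [])"
  define \<tau>' where "\<tau>' = \<tau>\<lparr>draws := draws \<tau> @ [(i, a)], pifo_answers := pifo_answers \<tau> @ [ans],
    fo_answers := fo_answers \<tau> @ fo\<rparr>"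
  define x' where "x' = proj ?X (next_point A (Suc m) ?X \<tau>')"
  have E_mono: "E j \<subseteq> E j'" if "j \<le> j'" for j j'
    unfolding E_def using euclid_mono[of "Suc j" "Suc j'"] that by auto
  have kk': "k \<le> k'" by (simp add: k'_def)
  have step: "step n A ?P \<tau> s = \<tau>'\<lparr>iterates := iterates \<tau> @ [x']\<rparr>"
    by (simp add: step_def s Let_def x'_def \<tau>'_def ans_def fo_def \<gamma>_def w_def)
  have iter: "set (iterates \<tau>) \<subseteq> E k" and av: "available \<tau> \<subseteq> E k" and ne: "iterates \<tau> \<noteq> []"
    using \<tau> unfolding explored_def E_def available_def by auto
  have \<gamma>: "0 < \<gamma>" using A by (simp add: \<gamma>_def pifo_algorithms_def)
  \<comment> \<open>the first edge, from \<open>k\<close> on, that the sampled component does not own\<close>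
  obtain k'' where k'': "k \<le> k''" "k'' \<le> k'" "w k'' = 0"
  proof (cases "w k = 0")
    case True
    then show ?thesis using that[of k] kk' by simp
  next
    case False
    then have "hit p q s" "w (Suc k) = 0"
      using n by (auto simp: w_def edge_weight_def hit_def s split: if_splits)
    then show ?thesis using that[of "Suc k"] by (simp add: k'_def)
  qed
  have w: "0 \<le> w j" for j using l by (simp add: w_def edge_weight_def)
  have 1: "(\<Union>(v, g, r) \<in> set ans. insert g (set_option r)) \<subseteq> E k'"
  proof (intro UN_least, clarify)
    fix v g r u assume "(v, g, r) \<in> set ans" and u: "u \<in> insert g (set_option r)"
    then obtain x where x: "x \<in> set (iterates \<tau>)"
      "pifo_oracle (Suc m) (chain_quad m \<mu> b w) x \<gamma> = (v, g, r)"
      by (auto simp: ans_def)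
    have "x \<in> E k''" using x iter E_mono[OF k''(1)] by auto
    then have "insert g (set_option r) \<subseteq> E k''"
      unfolding E_def using x(2) w k''(3) \<mu> \<gamma> by (intro pifo_answer_in_euclid)
    then show "u \<in> E k'" using u E_mono[OF k''(2)] by auto
  qed
  have 2: "snd ` set fo \<subseteq> E k'"
  proof (cases a)
    case True
    then have k': "k' = Suc k" by (simp add: k'_def hit_def s)
    have x: "last (iterates \<tau>) \<in> E k" using iter ne by auto
    then have "grad (Suc m) (objective n ?P) (last (iterates \<tau>)) =
        chain_grad m \<mu> b (\<lambda>_. l / real n) (last (iterates \<tau>))"
      using n by (simp add: objective_chain_problem grad_chain_quad E_def)
    moreover have "chain_grad m \<mu> b (\<lambda>_. l / real n) (last (iterates \<tau>)) \<in> euclid (Suc m)"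
      using x by (auto simp: E_def euclid_def chain_grad_def coord_chain_op)
    ultimately show ?thesis
      using True x chain_grad_in_euclid[of "last (iterates \<tau>)" k] by (simp add: fo_def fo_oracle_def E_def k')
  qed (simp add: fo_def)
  have "available \<tau>' \<subseteq> available \<tau> \<union> (\<Union>(v, g, r) \<in> set ans. insert g (set_option r)) \<union> snd ` set fo"
    unfolding available_def \<tau>'_def by auto
  then have av': "available \<tau>' \<subseteq> E k'" using av E_mono[OF kk'] 1 2 by blast
  have "next_point A (Suc m) ?X \<tau>' \<in> span (available \<tau>')"
    using A by (simp add: pifo_algorithms_def)
  then have "next_point A (Suc m) ?X \<tau>' \<in> E k'"
    using av' span_subset_euclid unfolding E_def by blast
  then have x': "x' \<in> E k'"
    using proj_ball[of _ "Suc k'" "Suc m" R] R unfolding x'_def E_def by blast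
  have "available (step n A ?P \<tau> s) \<subseteq> insert x' (available \<tau>')"
    unfolding step available_def by (auto simp: \<tau>'_def)
  then have "available (step n A ?P \<tau> s) \<subseteq> E k'" using av' x' by blast
  then show ?thesis unfolding k'_def[symmetric] explored_def by (simp add: step E_def)
qed

lemma point_at_in_euclid:
  assumes n: "p \<in> {1..n}" "q \<in> {1..n}" "p \<noteq> q" and l: "0 < l" and R: "0 \<le> R" and \<mu>: "0 \<le> \<mu>"
    and A: "A \<in> pifo_algorithms c0 n"
  shows "point_at n A (chain_problem m \<mu> b l R p q) \<omega> \<in> euclid (Suc (length (filter (hit p q) \<omega>)))"
proof -
  let ?P = "chain_problem m \<mu> b l R p q"
  have "explored m (length (filter (hit p q) \<omega>)) (foldl (step n A ?P) (initial n ?P) \<omega>)"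
  proof (induction \<omega> rule: rev_induct)
    case Nil
    have "grad (Suc m) (objective n ?P) 0 = chain_grad m \<mu> b (\<lambda>_. l / real n) 0"
      using n subspace_0[OF subspace_euclid] by (simp add: objective_chain_problem grad_chain_quad)
    also have "\<dots> \<in> euclid (Suc 0) \<inter> euclid (Suc m)"
      by (auto simp: euclid_def chain_grad_def coord_chain_op)
    finally show ?case
      using subspace_0[OF subspace_euclid]
      by (simp add: explored_def available_def initial_def fo_oracle_def)
  next
    case (snoc s \<omega>)
    show ?case using explored_step[OF n l R \<mu> A snoc.IH, of s b] by (cases "hit p q s") simp_all
  qed
  then show ?thesis
    unfolding point_at_def explored_def available_def using last_in_set by fastforce
qed

section \<open>The minimiser of the chain\<close>

text \<open>
  On an infinite path the minimiser would be geometric. On a finite path the free end acts like a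
  mirror between the vertices \<open>m\<close> and \<open>m + 1\<close>; adding the mirror image gives the exact minimiser
  and at most doubles the entries.
\<close>

definition two_sided_geometric :: "nat \<Rightarrow> real \<Rightarrow> real \<Rightarrow> real" where
  "two_sided_geometric m t u = exp (- (t * u)) + exp (- (t * (2 * real m + 1 - u)))"

lemma two_sided_geometric_recurrence:
  "two_sided_geometric m t (u - 1) + two_sided_geometric m t (u + 1) =
     (exp t + exp (- t)) * two_sided_geometric m t u"
proof -
  have "exp (- (t * (u - 1))) = exp t * exp (- (t * u))"
    "exp (- (t * (u + 1))) = exp (- t) * exp (- (t * u))"
    "exp (- (t * (2 * real m + 1 - (u - 1)))) = exp (- t) * exp (- (t * (2 * real m + 1 - u)))"
    "exp (- (t * (2 * real m + 1 - (u + 1)))) = exp t * exp (- (t * (2 * real m + 1 - u)))"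
    by (simp_all add: exp_add[symmetric] algebra_simps)
  then show ?thesis by (simp add: two_sided_geometric_def algebra_simps)
qed

lemma two_sided_geometric_symmetric:
  "two_sided_geometric m t (real m + 1) = two_sided_geometric m t (real m)"
  by (simp add: two_sided_geometric_def algebra_simps)

text \<open>
  In the interior this is the recurrence, at \<open>m\<close> the symmetry. At \<open>0\<close> the coefficient \<open>b\<close> of the linear
  term is chosen to make the equation hold.
\<close>

lemma chain_grad_two_sided_geometric:
  assumes m: "0 < m" and \<mu>: "\<mu> = \<theta> * (exp t + exp (- t) - 2)"
    and b: "b = C * (\<mu> * two_sided_geometric m t 0 +
      \<theta> * (two_sided_geometric m t 0 - two_sided_geometric m t 1))"
  shows "chain_grad m \<mu> b (\<lambda>_. \<theta>) (prefix_vec (Suc m) (\<lambda>j. C * two_sided_geometric m t (real j))) = 0"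
    (is "chain_grad m \<mu> b _ ?y = 0")
  unfolding fvec_eq_iff
proof
  fix k
  let ?g = "two_sided_geometric m t"
  have rec: "\<mu> * (C * ?g u) + \<theta> * (C * ?g u - C * ?g (u + 1)) - \<theta> * (C * ?g (u - 1) - C * ?g u) = 0" for u
  proof -
    have "?g (u - 1) + ?g (u + 1) = (exp t + exp (- t)) * ?g u"
      by (rule two_sided_geometric_recurrence)
    then have "\<theta> * C * (?g (u - 1) + ?g (u + 1)) = \<theta> * C * ((exp t + exp (- t)) * ?g u)" by simp
    then show ?thesis unfolding \<mu> by (simp add: algebra_simps)
  qed
  consider "k = 0" | "0 < k" "k < m" | "k = m" | "k > m" by linarith
  then show "coord (chain_grad m \<mu> b (\<lambda>_. \<theta>) ?y) k = coord 0 k"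
  proof cases
    case 1
    then show ?thesis using m by (simp add: chain_grad_def coord_chain_op b algebra_simps)
  next
    case 2
    then obtain i where "k = Suc i" by (cases k) auto
    then show ?thesis
      using 2 rec[of "real k"] by (simp add: chain_grad_def coord_chain_op add.commute)
  next
    case 3
    then obtain i where "k = Suc i" using m by (cases k) auto
    then show ?thesis
      using 3 rec[of "real k"] two_sided_geometric_symmetric[of m t]
      by (simp add: chain_grad_def coord_chain_op add.commute)
  next
    case 4
    then show ?thesis by (auto simp: chain_grad_def coord_chain_op)
  qed
qed

lemma norm_two_sided_geometric_le:
  assumes t: "0 < t"
  shows "(norm (prefix_vec (Suc m) (\<lambda>j. C * two_sided_geometric m t (real j))))\<^sup>2
    \<le> 4 * C\<^sup>2 / (1 - exp (- 2 * t))" (is "(norm ?y)\<^sup>2 \<le> _")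
proof -
  define r where "r = exp (- 2 * t)"
  have r: "0 < r" "r < 1" using t by (auto simp: r_def)
  have "(C * two_sided_geometric m t (real j))\<^sup>2 \<le> 4 * C\<^sup>2 * r ^ j" if "j < Suc m" for j
  proof -
    have "exp (- (t * (2 * real m + 1 - real j))) \<le> exp (- (t * real j))"
      using t that by simp
    then have "two_sided_geometric m t (real j) \<le> 2 * exp (- (t * real j))"
      by (simp add: two_sided_geometric_def)
    then have "(two_sided_geometric m t (real j))\<^sup>2 \<le> (2 * exp (- (t * real j)))\<^sup>2"
      by (rule power_mono) (simp add: two_sided_geometric_def)
    also have "\<dots> = 4 * r ^ j"
      by (simp add: r_def power_mult_distrib exp_of_nat_mult[symmetric] algebra_simps)
    finally have "C\<^sup>2 * (two_sided_geometric m t (real j))\<^sup>2 \<le> C\<^sup>2 * (4 * r ^ j)"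
      by (rule mult_left_mono) simp
    then show ?thesis by (simp add: power_mult_distrib)
  qed
  then have "(\<Sum>j<Suc m. (coord ?y j)\<^sup>2) \<le> (\<Sum>j<Suc m. 4 * C\<^sup>2 * r ^ j)"
    by (intro sum_mono) auto
  also have "\<dots> = 4 * C\<^sup>2 * (\<Sum>j<Suc m. r ^ j)" by (simp only: sum_distrib_left)
  also have "\<dots> \<le> 4 * C\<^sup>2 * (1 / (1 - r))"
  proof (rule mult_left_mono)
    have "(\<Sum>j<Suc m. r ^ j) = (1 - r ^ Suc m) / (1 - r)"
      using r sum_gp_strict[of r "Suc m"] by auto
    also have "\<dots> \<le> 1 / (1 - r)" using r by (intro divide_right_mono) auto
    finally show "(\<Sum>j<Suc m. r ^ j) \<le> 1 / (1 - r)" .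
  qed simp
  finally show ?thesis
    using norm_euclid[of ?y "Suc m"] by (simp add: r_def euclid_def)
qed

text \<open>
  A point supported on the coordinates up to \<open>k\<close> misses at least the entry \<open>k + 1\<close> of the
  minimiser, and strong convexity turns the distance into a gap of the values.
\<close>

lemma chain_gap:
  assumes \<theta>: "0 \<le> \<theta>" and \<mu>: "0 \<le> \<mu>" and C: "0 \<le> C" and km: "k < m" and x: "x \<in> euclid (Suc k)"
    and y: "y = prefix_vec (Suc m) (\<lambda>j. C * two_sided_geometric m t (real j))"
    and grad: "chain_grad m \<mu> b (\<lambda>_. \<theta>) y = 0"
  shows "chain_quad m \<mu> b (\<lambda>_. \<theta>) y + \<mu> / 2 * C\<^sup>2 * exp (- 2 * t * real (Suc k))
    \<le> chain_quad m \<mu> b (\<lambda>_. \<theta>) x"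
proof -
  have "C * exp (- (t * real (Suc k))) \<le> C * two_sided_geometric m t (real (Suc k))"
    using C by (intro mult_left_mono) (auto simp: two_sided_geometric_def)
  also have "\<dots> = - coord (x - y) (Suc k)"
    using x km by (simp add: y euclid_def)
  finally have "(C * exp (- (t * real (Suc k))))\<^sup>2 \<le> (- coord (x - y) (Suc k))\<^sup>2"
    using C by (intro power_mono) auto
  also have "\<dots> \<le> (norm (x - y))\<^sup>2"
    using coord_sq_le_norm_sq[of "x - y" "Suc k"] by (simp only: power2_minus)
  finally have "C\<^sup>2 * exp (- 2 * t * real (Suc k)) \<le> (norm (x - y))\<^sup>2"
    by (simp add: power_mult_distrib exp_double[symmetric] algebra_simps)
  then have "\<mu> / 2 * (C\<^sup>2 * exp (- 2 * t * real (Suc k))) \<le> \<mu> / 2 * (norm (x - y))\<^sup>2"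
    using \<mu> by (intro mult_left_mono) auto
  then show ?thesis
    using chain_quad_expand[of m \<mu> b "\<lambda>_. \<theta>" x y] chain_energy_nonneg[of "\<lambda>_. \<theta>" m "x - y"] \<theta> grad
    by (simp add: mult.assoc)
qed

section \<open>Counting hits\<close>

lemma finite_set_replicate_pmf:
  assumes "finite (set_pmf D)"
  shows "finite (set_pmf (replicate_pmf T D))"
  unfolding set_replicate_pmf using finite_lists_length_eq[OF assms, of T]
  by (simp add: lists_eq_set Collect_conj_eq[symmetric] conj_commute)

text \<open>
  The hits are independent, so the expectation is the \<open>T\<close>-th power of that for one draw, and for one
  draw the bound is Jensen's inequality for \<open>exp\<close>. It is proved by the tangent of \<open>exp\<close> at
  \<open>- r * \<beta>\<close>, which also absorbs that \<open>\<beta>\<close> is only an upper bound for the probability of a hit.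
\<close>

lemma expectation_exp_hits_ge:
  fixes D :: "'a pmf" and r \<beta> :: real
  assumes fin: "finite (set_pmf D)" and r: "0 \<le> r" and \<beta>: "measure_pmf.prob D {s. H s} \<le> \<beta>"
  shows "exp (- (r * \<beta> * real T))
    \<le> measure_pmf.expectation (replicate_pmf T D) (\<lambda>\<omega>. exp (- (r * real (length (filter H \<omega>)))))"
proof (induction T)
  case 0
  show ?case by simp
next
  case (Suc T)
  define S where "S = set_pmf D"
  define e where "e = (\<lambda>T. measure_pmf.expectation (replicate_pmf T D)
    (\<lambda>\<omega>. exp (- (r * real (length (filter H \<omega>))))))"
  note finT = finite_set_replicate_pmf[OF fin, of T]
  have "exp (- (r * \<beta>)) * (1 - r * (\<Sum>s\<in>S. pmf D s * of_bool (H s)) + r * \<beta>)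
      = (\<Sum>s\<in>S. pmf D s * (exp (- (r * \<beta>)) * (1 - r * of_bool (H s) + r * \<beta>)))"
  proof -
    have "(\<Sum>s\<in>S. pmf D s * (exp (- (r * \<beta>)) * (1 - r * of_bool (H s) + r * \<beta>))) =
      (\<Sum>s\<in>S. pmf D s * (exp (- (r * \<beta>)) * (1 + r * \<beta>)) - exp (- (r * \<beta>)) * r * (pmf D s * of_bool (H s)))"
      by (intro sum.cong) (auto simp: algebra_simps)
    also have "\<dots> = (\<Sum>s\<in>S. pmf D s) * (exp (- (r * \<beta>)) * (1 + r * \<beta>)) -
        exp (- (r * \<beta>)) * r * (\<Sum>s\<in>S. pmf D s * of_bool (H s))"
      by (simp only: sum_subtractf sum_distrib_left sum_distrib_right)
    also have "(\<Sum>s\<in>S. pmf D s) = 1" unfolding S_def by (rule sum_pmf_eq_1[OF fin]) simp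
    finally show ?thesis by (simp add: algebra_simps)
  qed
  also have "\<dots> \<le> (\<Sum>s\<in>S. pmf D s * exp (- (r * of_bool (H s))))"
  proof (intro sum_mono mult_left_mono)
    fix s
    have "exp (- (r * \<beta>)) * (1 + (r * \<beta> - r * of_bool (H s))) \<le>
        exp (- (r * \<beta>)) * exp (r * \<beta> - r * of_bool (H s))"
      by (intro mult_left_mono exp_ge_add_one_self) simp
    also have "\<dots> = exp (- (r * of_bool (H s)))" by (simp add: exp_add[symmetric])
    finally show "exp (- (r * \<beta>)) * (1 - r * of_bool (H s) + r * \<beta>) \<le> exp (- (r * of_bool (H s)))"
      by (simp add: algebra_simps)
  qed simp
  finally have *: "exp (- (r * \<beta>)) * (1 - r * (\<Sum>s\<in>S. pmf D s * of_bool (H s)) + r * \<beta>)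
    \<le> (\<Sum>s\<in>S. pmf D s * exp (- (r * of_bool (H s))))" .
  have "(\<Sum>s\<in>S. pmf D s * of_bool (H s)) = measure_pmf.prob D ({s. H s} \<inter> S)"
    unfolding S_def using fin
    by (subst measure_measure_pmf_finite) (auto simp: Int_def conj_commute intro!: sum.mono_neutral_cong_right)
  also have "\<dots> \<le> \<beta>" using \<beta> by (simp add: S_def measure_Int_set_pmf)
  finally have "r * (\<Sum>s\<in>S. pmf D s * of_bool (H s)) \<le> r * \<beta>" using r by (rule mult_left_mono)
  then have le: "exp (- (r * \<beta>)) * 1 \<le>
      exp (- (r * \<beta>)) * (1 - r * (\<Sum>s\<in>S. pmf D s * of_bool (H s)) + r * \<beta>)"
    by (intro mult_left_mono) auto
  from order_trans[OF le *]
  have one: "exp (- (r * \<beta>)) \<le> (\<Sum>s\<in>S. pmf D s * exp (- (r * of_bool (H s))))"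
    by (simp only: mult_1_right)
  have "exp (- (r * \<beta> * real (Suc T))) = exp (- (r * \<beta>)) * exp (- (r * \<beta> * real T))"
    by (simp add: exp_add[symmetric] algebra_simps)
  also have "\<dots> \<le> (\<Sum>s\<in>S. pmf D s * exp (- (r * of_bool (H s)))) * e T"
    using one Suc.IH by (intro mult_mono sum_nonneg) (auto simp: e_def)
  also have "\<dots> = (\<Sum>s\<in>S. pmf D s * (exp (- (r * of_bool (H s))) * e T))"
    by (simp add: sum_distrib_right mult.assoc)
  also have "\<dots> = e (Suc T)"
  proof -
    have "measure_pmf.expectation (replicate_pmf T D \<bind> (\<lambda>xs. return_pmf (s # xs)))
        (\<lambda>\<omega>. exp (- (r * real (length (filter H \<omega>))))) = exp (- (r * of_bool (H s))) * e T" for s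
    proof -
      have "measure_pmf.expectation (replicate_pmf T D \<bind> (\<lambda>xs. return_pmf (s # xs)))
          (\<lambda>\<omega>. exp (- (r * real (length (filter H \<omega>))))) =
        measure_pmf.expectation (replicate_pmf T D)
          (\<lambda>xs. exp (- (r * of_bool (H s))) * exp (- (r * real (length (filter H xs)))))"
        unfolding map_pmf_def[symmetric] integral_map_pmf
        by (intro Bochner_Integration.integral_cong) (auto simp: exp_add[symmetric] algebra_simps)
      then show ?thesis by (simp add: e_def)
    qed
    moreover have "finite (set_pmf (replicate_pmf T D \<bind> (\<lambda>xs. return_pmf (s # xs))))" for s
      using finT by simp
    ultimately show ?thesis
      unfolding e_def replicate_pmf.simps S_def
      by (subst pmf_expectation_bind[OF fin]) auto
  qed
  finally show ?case by (simp add: e_def)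
qed

lemma ex_small_pmf:
  assumes "finite B" "B \<noteq> {}"
  shows "\<exists>i\<in>B. pmf D i \<le> 1 / real (card B)"
proof (rule ccontr)
  assume "\<not> ?thesis"
  then have "(\<Sum>i\<in>B. 1 / real (card B)) < (\<Sum>i\<in>B. pmf D i)"
    using assms by (intro sum_strict_mono) (auto simp: not_le)
  moreover have "(\<Sum>i\<in>B. pmf D i) \<le> 1"
    using assms(1) by (simp add: measure_measure_pmf_finite[symmetric])
  ultimately show False using assms by simp
qed

lemma prob_hit_le:
  assumes "0 \<le> \<rho>" "\<rho> \<le> 1"
  shows "measure_pmf.prob (pair_pmf D (bernoulli_pmf \<rho>)) {s. hit p q s} \<le> pmf D p + pmf D q + \<rho>"
proof -
  let ?M = "pair_pmf D (bernoulli_pmf \<rho>)"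
  have "{s. hit p q s} \<subseteq> (fst -` {p} \<union> fst -` {q}) \<union> snd -` {True}"
    by (auto simp: hit_def)
  then have "measure_pmf.prob ?M {s. hit p q s} \<le>
      measure_pmf.prob ?M ((fst -` {p} \<union> fst -` {q}) \<union> snd -` {True})"
    by (rule measure_pmf.finite_measure_mono) simp
  also have "\<dots> \<le> measure_pmf.prob ?M (fst -` {p}) + measure_pmf.prob ?M (fst -` {q}) +
      measure_pmf.prob ?M (snd -` {True})"
    by (intro order_trans[OF measure_Un_le] add_right_mono measure_Un_le) simp_all
  also have "\<dots> = pmf D p + pmf D q + \<rho>"
    unfolding measure_map_pmf[symmetric] map_fst_pair_pmf map_snd_pair_pmf
    using assms by (simp add: measure_pmf_single)
  finally show ?thesis .
qed

section \<open>The lower bound for one algorithm and for the complexity\<close>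

text \<open>
  The problem may depend on the algorithm and on the horizon \<open>T0\<close>. The components with edges are
  two unlikely ones, with probabilities at most \<open>1 / n\<close> and \<open>1 / (n - 1) \<le> 2 / n\<close>,
  so that a hit has probability at most \<open>(3 + c0) / n\<close>. The chain is too long to be
  explored in \<open>T0\<close> steps, while the constant in front of the exponential does not depend on its
  length, because the geometric series keeps the norm of the minimiser bounded. The number \<open>t\<close> is the rate of
  decay of the minimiser; the condition on it says that the edge weight which produces this decay
  is compatible with average smoothness.
\<close>

lemma hard_problem_exists:
  fixes n :: nat and L \<mu> R t c0 :: real
  assumes n: "4 \<le> n" and \<mu>: "0 < \<mu>" "2 * \<mu> \<le> L" and R: "0 < R" and t: "0 < t"
    and cond: "16 * sqrt (real n) * \<mu> \<le> L * (exp t + exp (- t) - 2)"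
    and A: "A \<in> pifo_algorithms c0 n"
  shows "\<exists>P\<in>convex_class n R L \<mu>. \<forall>T\<le>T0.
    \<mu> * R\<^sup>2 / 8 * (1 - exp (- 2 * t)) * exp (- 2 * t) * exp (- (2 * t * ((3 + c0) / real n) * real T))
    \<le> expected_value n A P T - (INF x\<in>feasible P. objective n P x)"
proof -
  let ?D = "index_distr A" and ?\<rho> = "full_prob A"
  have L: "0 < L" using \<mu> by linarith
  obtain p where p: "p \<in> {1..n}" "pmf ?D p \<le> 1 / real n"
    using ex_small_pmf[of "{1..n}" ?D] n by auto
  obtain q where q: "q \<in> {1..n} - {p}" "pmf ?D q \<le> 1 / real (card ({1..n} - {p}))"
  proof -
    have "card ({1..n} - {p}) = n - 1" using p by simp
    then have "card ({1..n} - {p}) \<noteq> 0" using n by simp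
    then have "{1..n} - {p} \<noteq> {}" by (metis card.empty)
    then show ?thesis using ex_small_pmf[of "{1..n} - {p}" ?D] that by blast
  qed
  have "card ({1..n} - {p}) = n - 1" using p by simp
  then have "pmf ?D q \<le> 1 / (real n - 1)" using q n by (simp add: of_nat_diff)
  also have "\<dots> \<le> 2 / real n" using n by (simp add: field_simps)
  finally have q': "pmf ?D q \<le> 2 / real n" .
  have pq: "p \<in> {1..n}" "q \<in> {1..n}" "p \<noteq> q" using p q by auto
  have \<rho>: "0 \<le> ?\<rho>" "?\<rho> \<le> 1" "?\<rho> \<le> c0 / real n"
    using A by (auto simp: pifo_algorithms_def)
  define \<beta> where "\<beta> = (3 + c0) / real n"
  have \<beta>: "measure_pmf.prob (pair_pmf ?D (bernoulli_pmf ?\<rho>)) {s. hit p q s} \<le> \<beta>"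
    using prob_hit_le[OF \<rho>(1,2), of ?D p q] p(2) q' \<rho>(3) by (simp add: \<beta>_def add_divide_distrib)

  define \<sigma> where "\<sigma> = exp t + exp (- t) - 2"
  define \<theta> where "\<theta> = \<mu> / \<sigma>"
  define l where "l = real n * \<theta>"
  \<comment> \<open>the scale that makes the bound on the norm of the minimiser equal to \<open>R\<close>\<close>
  define C where "C = R * sqrt (1 - exp (- 2 * t)) / 2"
  \<comment> \<open>at most \<open>T0\<close> hits, and the entry after the last explored coordinate must exist\<close>
  define m where "m = Suc T0"
  define b where "b = C * (\<mu> * two_sided_geometric m t 0 +
      \<theta> * (two_sided_geometric m t 0 - two_sided_geometric m t 1))"
  define y where "y = prefix_vec (Suc m) (\<lambda>j. C * two_sided_geometric m t (real j))"
  define P where "P = chain_problem m \<mu> b l R p q"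
  have "0 < 16 * sqrt (real n) * \<mu>" using n \<mu> by simp
  then have "0 < L * \<sigma>" using cond unfolding \<sigma>_def by (rule less_le_trans)
  then have \<sigma>: "0 < \<sigma>" using L by (simp add: zero_less_mult_iff)
  have \<theta>: "0 < \<theta>" "\<mu> = \<theta> * \<sigma>" using \<mu> \<sigma> by (simp_all add: \<theta>_def)
  have l: "0 < l" "l / real n = \<theta>" using n \<theta> by (simp_all add: l_def)
  have e: "0 < 1 - exp (- 2 * t)" using t by simp
  have C: "0 \<le> C" "C\<^sup>2 = R\<^sup>2 * (1 - exp (- 2 * t)) / 4"
    using R e by (simp_all add: C_def power_mult_distrib power_divide)
  have "16 * sqrt (real n) * \<theta> \<le> L"
    using cond \<sigma> by (simp add: \<theta>_def \<sigma>_def[symmetric] field_simps)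
  then have "(16 * sqrt (real n) * \<theta>)\<^sup>2 \<le> L\<^sup>2"
    using \<theta> by (intro power_mono) auto
  then have "256 * (real n * \<theta>\<^sup>2) \<le> L\<^sup>2" by (simp add: power_mult_distrib mult.assoc)
  moreover have "64 * l\<^sup>2 / real n = 64 * (real n * \<theta>\<^sup>2)"
    using n by (simp add: l_def power2_eq_square)
  moreover have "\<mu>\<^sup>2 * (1 + 2 / real n) \<le> L\<^sup>2 / 4 * (3 / 2)"
  proof (rule mult_mono)
    have "(2 * \<mu>)\<^sup>2 \<le> L\<^sup>2" using \<mu> by (intro power_mono) auto
    then show "\<mu>\<^sup>2 \<le> L\<^sup>2 / 4" by (simp add: power_mult_distrib)
  qed (use n in \<open>auto simp: field_simps\<close>)
  ultimately have sm: "\<mu>\<^sup>2 * (1 + 2 / real n) + 64 * l\<^sup>2 / real n \<le> L\<^sup>2"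
    using zero_le_power2[of L] by linarith
  have P: "P \<in> convex_class n R L \<mu>"
    unfolding P_def using pq l R sm by (intro chain_problem_in_convex_class) auto

  have obj: "objective n P = chain_quad m \<mu> b (\<lambda>_. \<theta>)"
    unfolding P_def using pq l by (simp add: objective_chain_problem)
  have grad: "chain_grad m \<mu> b (\<lambda>_. \<theta>) y = 0"
    unfolding y_def using \<theta> by (intro chain_grad_two_sided_geometric) (auto simp: m_def \<sigma>_def b_def)
  have min: "objective n P y \<le> objective n P x" for x
    using chain_quad_expand[of m \<mu> b "\<lambda>_. \<theta>" x y] chain_energy_nonneg[of "\<lambda>_. \<theta>" m "x - y"] \<theta>(1) \<mu>(1)
    by (simp add: obj grad)
  have "(norm y)\<^sup>2 \<le> R\<^sup>2"
    using norm_two_sided_geometric_le[OF t, of m C] e unfolding y_def[symmetric] C(2) by simp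
  then have "norm y \<le> R" by (rule power2_le_imp_le) (use R in simp)
  then have y: "y \<in> feasible P"
    by (simp add: P_def) (simp add: y_def euclid_def)
  have inf: "(INF x\<in>feasible P. objective n P x) \<le> objective n P y"
    using y min by (intro cINF_lower) (auto intro!: bdd_belowI[of _ "objective n P y"])

  define N where "N = (\<lambda>\<omega>. length (filter (hit p q) \<omega>))"
  define c where "c = \<mu> / 2 * C\<^sup>2 * exp (- 2 * t)"
  have gap: "objective n P y + c * exp (- (2 * t * real (N \<omega>))) \<le> objective n P (point_at n A P \<omega>)"
    if "length \<omega> \<le> T0" for \<omega>
  proof -
    have "N \<omega> < m"
      using that length_filter_le[of "hit p q" \<omega>] unfolding N_def m_def by linarith
    moreover have "point_at n A P \<omega> \<in> euclid (Suc (N \<omega>))"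
      unfolding P_def N_def using pq l R \<mu> A by (intro point_at_in_euclid) auto
    ultimately have "objective n P y + \<mu> / 2 * C\<^sup>2 * exp (- 2 * t * real (Suc (N \<omega>)))
        \<le> objective n P (point_at n A P \<omega>)"
      unfolding obj using \<theta> \<mu> C y_def grad by (intro chain_gap) auto
    moreover have "exp (- 2 * t * real (Suc (N \<omega>))) = exp (- 2 * t) * exp (- (2 * t * real (N \<omega>)))"
      by (simp add: exp_add[symmetric] algebra_simps)
    ultimately show ?thesis by (simp add: c_def mult.assoc)
  qed

  have "\<mu> * R\<^sup>2 / 8 * (1 - exp (- 2 * t)) * exp (- 2 * t) * exp (- (2 * t * \<beta> * real T))
    \<le> expected_value n A P T - (INF x\<in>feasible P. objective n P x)" if T: "T \<le> T0" for T
  proof -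
    let ?D' = "pair_pmf ?D (bernoulli_pmf ?\<rho>)"
    let ?M = "measure_pmf (replicate_pmf T ?D')"
    have "set_pmf ?D \<subseteq> {1..n}" using A by (simp add: pifo_algorithms_def)
    then have "finite (set_pmf ?D)" by (rule finite_subset) simp
    then have fin: "finite (set_pmf ?D')" by simp
    have int: "integrable ?M f" for f :: "_ \<Rightarrow> real"
      by (intro integrable_measure_pmf_finite finite_set_replicate_pmf fin)
    have "objective n P y + c * exp (- (2 * t * \<beta> * real T)) \<le>
        objective n P y + c * measure_pmf.expectation (replicate_pmf T ?D') (\<lambda>\<omega>. exp (- (2 * t * real (N \<omega>))))"
      unfolding N_def using expectation_exp_hits_ge[OF fin _ \<beta>, of "2 * t" T] t \<mu>
      by (intro add_left_mono mult_left_mono) (auto simp: c_def)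
    also have "\<dots> = measure_pmf.expectation (replicate_pmf T ?D')
        (\<lambda>\<omega>. objective n P y + c * exp (- (2 * t * real (N \<omega>))))"
      using int by (simp add: measure_pmf.prob_space)
    also have "\<dots> \<le> expected_value n A P T"
      unfolding expected_value_def
      using T by (intro integral_mono_AE int) (auto simp: AE_measure_pmf_iff set_replicate_pmf intro!: gap)
    finally have "c * exp (- (2 * t * \<beta> * real T)) \<le>
        expected_value n A P T - (INF x\<in>feasible P. objective n P x)" using inf by linarith
    moreover have "c = \<mu> * R\<^sup>2 / 8 * (1 - exp (- 2 * t)) * exp (- 2 * t)"
      by (simp add: c_def C(2))
    ultimately show ?thesis by simp
  qed
  then show ?thesis using P unfolding \<beta>_def by blast
qed

lemma complexity_lower_bound:
  fixes n :: nat and L \<mu> R t c0 \<epsilon> S :: real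
  assumes n: "4 \<le> n" and \<mu>: "0 < \<mu>" "2 * \<mu> \<le> L" and R: "0 < R" and t: "0 < t"
    and cond: "16 * sqrt (real n) * \<mu> \<le> L * (exp t + exp (- t) - 2)"
    and c0: "0 < c0" and \<epsilon>: "0 < \<epsilon>"
    and S: "S = \<mu> * R\<^sup>2 / 8 * (1 - exp (- 2 * t)) * exp (- 2 * t)"
  shows "ereal (real n / (2 * (3 + c0) * t) * ln (S / \<epsilon>)) \<le> ereal_of_enat (complexity c0 n \<epsilon> R L \<mu>)"
proof -
  define x where "x = real n / (2 * (3 + c0) * t) * ln (S / \<epsilon>)"
  define N where "N = nat \<lceil>x\<rceil>"
  have S0: "0 < S" using \<mu> R t by (simp add: S)
  have le: "\<epsilon> \<le> S * exp (- (2 * t * ((3 + c0) / real n) * real T))" if "T < N" for T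
  proof -
    have "real T < x" using that unfolding N_def by linarith
    then have "2 * t * ((3 + c0) / real n) * real T \<le> 2 * t * ((3 + c0) / real n) * x"
      using t c0 by (intro mult_left_mono) auto
    also have "\<dots> = ln (S / \<epsilon>)"
    proof -
      have "2 * t * (K / real n) * (real n / (2 * K * t) * z) = z" if "0 < K" for K z :: real
        using that t n by simp
      from this[of "3 + c0"] show ?thesis using c0 unfolding x_def by simp
    qed
    finally have "exp (- ln (S / \<epsilon>)) \<le> exp (- (2 * t * ((3 + c0) / real n) * real T))" by simp
    moreover have "exp (- ln (S / \<epsilon>)) = \<epsilon> / S" using S0 \<epsilon> by (simp add: exp_minus)
    ultimately show ?thesis using S0 by (simp add: field_simps)
  qed
  have "enat N \<le> complexity c0 n \<epsilon> R L \<mu>"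
    unfolding complexity_def
  proof (rule INF_greatest)
    fix A assume A: "A \<in> pifo_algorithms c0 n"
    obtain P where P: "P \<in> convex_class n R L \<mu>"
      "\<And>T. T \<le> N \<Longrightarrow> S * exp (- (2 * t * ((3 + c0) / real n) * real T))
        \<le> expected_value n A P T - (INF x\<in>feasible P. objective n P x)"
      using hard_problem_exists[OF n \<mu> R t cond A, of N] unfolding S by blast
    have "enat N \<le> steps_needed n A P \<epsilon>"
      unfolding steps_needed_def
    proof (rule Inf_greatest, clarify)
      fix T assume less: "expected_value n A P T - (INF x\<in>feasible P. objective n P x) < \<epsilon>"
      show "enat N \<le> enat T"
      proof (rule ccontr)
        assume "\<not> enat N \<le> enat T"
        then have "T < N" by simp
        then show False using le[of T] P(2)[of T] less by simp
      qed
    qed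
    then show "enat N \<le> (SUP P\<in>convex_class n R L \<mu>. steps_needed n A P \<epsilon>)"
      using P(1) by (rule SUP_upper2[rotated])
  qed
  then have "ereal_of_enat (enat N) \<le> ereal_of_enat (complexity c0 n \<epsilon> R L \<mu>)"
    by (simp only: ereal_of_enat_le_iff)
  moreover have "x \<le> real N" unfolding N_def by linarith
  then have "ereal x \<le> ereal_of_enat (enat N)" by simp
  ultimately show ?thesis unfolding x_def by (meson order_trans)
qed

lemma power2_half_le_cosh:
  assumes "0 \<le> (t::real)"
  shows "t\<^sup>2 / 2 \<le> exp t + exp (- t) - 2"
  using exp_lower_Taylor_quadratic[OF assms] exp_ge_add_one_self[of "- t"] by simp

text \<open>
  The smaller the decay parameter \<open>t\<close>, the better the bound. The least value that smoothness
  admits solves \<open>exp t + exp (- t) - 2 = 16 \<surd>n / \<kappa>\<close>; it is of the order of the square root of the right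
  side when this is small and of its logarithm when it is large. The values \<open>t1\<close> and \<open>t2\<close> below are
  explicit admissible values of these sizes.
\<close>

theorem theoremE9:
  fixes c0 c1 c2 :: real
  assumes "c0 > 0" "c1 > 0" "c2 > 0"
  shows "\<exists>c>0. \<forall>(n::nat) (L::real) (\<mu>::real) (R::real).
    n \<ge> 4 \<and> L > 0 \<and> \<mu> > 0 \<and> R > 0 \<and> L / \<mu> \<ge> 2 \<longrightarrow>
    (\<exists>s>0. \<forall>\<epsilon>. \<epsilon> > 0 \<and> \<epsilon> \<le> L * R\<^sup>2 / 4 \<longrightarrow>
      (L / \<mu> \<ge> c1 * sqrt (real n) \<longrightarrow>
        ereal (c * ((real n + real n powr (3/4) * sqrt (L / \<mu>)) * ln (s / \<epsilon>)))
          \<le> ereal_of_enat (complexity c0 n \<epsilon> R L \<mu>)) \<and>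
      (L / \<mu> \<le> c2 * sqrt (real n) \<longrightarrow>
        ereal (c * (real n + real n / (1 + max (ln (sqrt (real n) / (L / \<mu>))) 0) * ln (s / \<epsilon>)))
          \<le> ereal_of_enat (complexity c0 n \<epsilon> R L \<mu>)))"
proof -
  define c where "c = min (1 / (12 * (3 + c0) * (1 + 1 / sqrt c1))) (1 / (10 * (3 + c0)))"
  have c: "0 < c" "c \<le> 1 / (12 * (3 + c0) * (1 + 1 / sqrt c1))" "c \<le> 1 / (10 * (3 + c0))"
  proof -
    have "0 < 1 + 1 / sqrt c1" using assms by (intro add_pos_nonneg) auto
    then show "0 < c" using assms by (simp add: c_def)
  qed (simp_all only: c_def min.cobounded1 min.cobounded2)
  show ?thesis
  proof (rule exI[of _ c], intro conjI allI impI c(1))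
    fix n :: nat and L \<mu> R :: real
    assume "n \<ge> 4 \<and> L > 0 \<and> \<mu> > 0 \<and> R > 0 \<and> L / \<mu> \<ge> 2"
    then have n: "4 \<le> n" and pos: "0 < L" "0 < \<mu>" "0 < R" and \<kappa>: "2 \<le> L / \<mu>" by auto
    then have \<mu>L: "2 * \<mu> \<le> L" by (simp add: field_simps)
    define \<kappa> where "\<kappa> = L / \<mu>"
    define h where "h = real n powr (1 / 4)"
    have k: "0 < \<kappa>" "L = \<kappa> * \<mu>" using pos by (simp_all add: \<kappa>_def)
    have h: "0 < h" "h\<^sup>2 = sqrt (real n)" "real n = h * real n powr (3 / 4)"
      using n by (simp_all add: h_def powr_power powr_half_sqrt[symmetric] powr_add[symmetric])
    define w where "w = 1 + max (ln (sqrt (real n) / \<kappa>)) 0"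
    define t1 where "t1 = 6 * h / sqrt \<kappa>"
    define t2 where "t2 = ln (2 + 16 * sqrt (real n) / \<kappa>)"
    define S where "S = (\<lambda>t. \<mu> * R\<^sup>2 / 8 * (1 - exp (- 2 * t)) * exp (- 2 * t))"
    \<comment> \<open>the factor \<open>exp (- w)\<close> turns the additive term \<open>n\<close> into part of the logarithmic term\<close>
    define s where "s = min (S t1) (S t2 * exp (- w))"
    have w: "1 \<le> w" by (simp add: w_def)
    have u: "0 \<le> 16 * sqrt (real n) / \<kappa>" using k by simp
    have t1: "0 < t1" using h k by (simp add: t1_def)
    have t2: "0 < t2" unfolding t2_def using u by (intro ln_gt_zero) linarith
    have Spos: "0 < S t" if "0 < t" for t using that pos by (simp add: S_def)
    have s: "0 < s" "s \<le> S t1" "s \<le> S t2 * exp (- w)"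
      using Spos[OF t1] Spos[OF t2] by (simp_all add: s_def)
    have bound: "ereal (real n / (2 * (3 + c0) * t) * ln (S t / \<epsilon>)) \<le> ereal_of_enat (complexity c0 n \<epsilon> R L \<mu>)"
      if "0 < t" "0 < \<epsilon>" "16 * sqrt (real n) / \<kappa> \<le> exp t + exp (- t) - 2" for t \<epsilon>
    proof (rule complexity_lower_bound[OF n pos(2) \<mu>L pos(3) that(1) _ assms(1) that(2) S_def[THEN fun_cong]])
      have "16 * sqrt (real n) \<le> \<kappa> * (exp t + exp (- t) - 2)"
        using that(3) k(1) by (simp add: pos_divide_le_eq mult.commute)
      then have "16 * sqrt (real n) * \<mu> \<le> \<kappa> * (exp t + exp (- t) - 2) * \<mu>"
        using pos by (intro mult_right_mono) auto
      then show "16 * sqrt (real n) * \<mu> \<le> L * (exp t + exp (- t) - 2)"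
        by (simp add: k(2) algebra_simps)
    qed
    \<comment> \<open>a negative logarithm makes the left side nonpositive, so large \<open>\<epsilon>\<close> need no separate argument\<close>
    have scale: "ereal (c * r * x) \<le> ereal_of_enat Z"
      if "ereal (K * x') \<le> ereal_of_enat Z" "c * r \<le> K" "0 \<le> c * r" "x \<le> x'" for r x x' K :: real and Z
    proof (cases "0 \<le> x")
      case True
      have "c * r * x \<le> K * x'" using that True by (intro mult_mono) auto
      then show ?thesis using that(1) order_trans ereal_less_eq(3) by blast
    next
      case False
      then have "c * r * x \<le> 0" using that by (simp add: mult_le_0_iff)
      then have "ereal (c * r * x) \<le> 0" by simp
      also have "0 \<le> ereal_of_enat Z" by simp
      finally show ?thesis .
    qed
    show "\<exists>s>0. \<forall>\<epsilon>. \<epsilon> > 0 \<and> \<epsilon> \<le> L * R\<^sup>2 / 4 \<longrightarrow>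
      (L / \<mu> \<ge> c1 * sqrt (real n) \<longrightarrow>
        ereal (c * ((real n + real n powr (3/4) * sqrt (L / \<mu>)) * ln (s / \<epsilon>)))
          \<le> ereal_of_enat (complexity c0 n \<epsilon> R L \<mu>)) \<and>
      (L / \<mu> \<le> c2 * sqrt (real n) \<longrightarrow>
        ereal (c * (real n + real n / (1 + max (ln (sqrt (real n) / (L / \<mu>))) 0) * ln (s / \<epsilon>)))
          \<le> ereal_of_enat (complexity c0 n \<epsilon> R L \<mu>))"
      unfolding \<kappa>_def[symmetric] w_def[symmetric]
    proof (intro exI[of _ s] conjI allI impI s(1); elim conjE)
      fix \<epsilon> :: real assume \<epsilon>: "0 < \<epsilon>" and large: "c1 * sqrt (real n) \<le> \<kappa>"
      have "16 * sqrt (real n) / \<kappa> \<le> t1\<^sup>2 / 2"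
        using k h by (simp add: t1_def power_divide power_mult_distrib field_simps)
      also have "\<dots> \<le> exp t1 + exp (- t1) - 2" using t1 by (intro power2_half_le_cosh) simp
      finally have B: "ereal (real n / (2 * (3 + c0) * t1) * ln (S t1 / \<epsilon>))
          \<le> ereal_of_enat (complexity c0 n \<epsilon> R L \<mu>)" using t1 \<epsilon> by (intro bound)
      define r where "r = real n powr (3 / 4) * sqrt \<kappa>"
      have r: "0 \<le> r" using k by (simp add: r_def)
      have "sqrt c1 * h \<le> sqrt \<kappa>"
      proof -
        have "sqrt (c1 * h\<^sup>2) \<le> sqrt \<kappa>"
          using large unfolding h(2) by (rule real_sqrt_le_mono)
        then show ?thesis using h(1) by (simp only: real_sqrt_mult real_sqrt_abs abs_of_pos)
      qed
      then have "real n powr (3 / 4) * (sqrt c1 * h) \<le> r"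
        unfolding r_def by (intro mult_left_mono) auto
      then have "sqrt c1 * real n \<le> r" by (subst h(3)) (simp add: mult_ac)
      then have "real n \<le> r / sqrt c1" using assms by (simp add: field_simps)
      then have "real n + r \<le> (1 + 1 / sqrt c1) * r" by (simp add: algebra_simps)
      then have "c * (real n + r) \<le> c * ((1 + 1 / sqrt c1) * r)" using c by (intro mult_left_mono) auto
      also have "\<dots> \<le> 1 / (12 * (3 + c0) * (1 + 1 / sqrt c1)) * ((1 + 1 / sqrt c1) * r)"
        using c r assms by (intro mult_right_mono mult_nonneg_nonneg add_nonneg_nonneg) auto
      also have "\<dots> = r / (12 * (3 + c0))"
      proof -
        have "1 + 1 / sqrt c1 \<noteq> 0" using assms by (smt (verit) divide_pos_pos real_sqrt_gt_zero)
        then show ?thesis by (simp add: divide_simps)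
      qed
      also have "\<dots> = real n / (2 * (3 + c0) * t1)"
      proof -
        have "a * x / (12 * K) = (h * a) / (2 * K * (6 * h / x))" if "0 < K" "0 < x" for a x K :: real
          using that h(1) by (simp add: field_simps)
        from this[of "3 + c0" "sqrt \<kappa>" "real n powr (3 / 4)"]
        show ?thesis unfolding r_def t1_def h(3)[symmetric] using k assms by simp
      qed
      finally have "c * (real n + r) \<le> real n / (2 * (3 + c0) * t1)" .
      moreover have "0 \<le> c * (real n + r)" using c r by simp
      moreover have "ln (s / \<epsilon>) \<le> ln (S t1 / \<epsilon>)"
        using s \<epsilon> by (intro ln_mono divide_right_mono divide_pos_pos) auto
      ultimately have "ereal (c * (real n + r) * ln (s / \<epsilon>)) \<le> ereal_of_enat (complexity c0 n \<epsilon> R L \<mu>)"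
        using B by (intro scale)
      then show "ereal (c * ((real n + real n powr (3 / 4) * sqrt \<kappa>) * ln (s / \<epsilon>)))
          \<le> ereal_of_enat (complexity c0 n \<epsilon> R L \<mu>)"
        by (simp add: r_def mult.assoc)
    next
      fix \<epsilon> :: real assume \<epsilon>: "0 < \<epsilon>"
      have "exp t2 = 2 + 16 * sqrt (real n) / \<kappa>"
        unfolding t2_def using u by (intro exp_ln) linarith
      then have "16 * sqrt (real n) / \<kappa> \<le> exp t2 + exp (- t2) - 2" by simp
      then have B: "ereal (real n / (2 * (3 + c0) * t2) * ln (S t2 / \<epsilon>))
          \<le> ereal_of_enat (complexity c0 n \<epsilon> R L \<mu>)" using t2 \<epsilon> by (intro bound)
      have "t2 \<le> 5 * w"
      proof -
        define v where "v = sqrt (real n) / \<kappa>"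
        have v: "0 < v" using n k by (simp add: v_def)
        have "v = exp (ln v)" using v by simp
        also have "\<dots> \<le> exp (w - 1)" unfolding w_def v_def by simp
        finally have v_le: "v \<le> exp (w - 1)" .
        have "(2::real) \<le> exp 1" using exp_ge_add_one_self[of 1] by simp
        then have "(2::real) ^ 5 \<le> exp 1 ^ 5" by (rule power_mono) simp
        then have e5: "32 \<le> exp (5::real)" by (simp add: exp_of_nat_mult[symmetric])
        have "2 + 16 * v \<le> 18 * exp (w - 1)"
          using v_le exp_ge_add_one_self[of "w - 1"] w by linarith
        also have "\<dots> \<le> exp 5 * exp (5 * (w - 1))"
          using e5 w by (intro mult_mono) auto
        also have "\<dots> = exp (5 * w)" by (simp add: exp_add[symmetric])
        finally have "ln (2 + 16 * v) \<le> ln (exp (5 * w))" using v by (intro ln_mono) auto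
        then have "ln (2 + 16 * v) \<le> 5 * w" by simp
        then show ?thesis by (simp add: t2_def v_def)
      qed
      have "c * (real n / w) \<le> 1 / (10 * (3 + c0)) * (real n / w)"
        using c w by (intro mult_right_mono) auto
      also have "\<dots> = real n / (2 * (3 + c0) * (5 * w))" by simp
      also have "\<dots> \<le> real n / (2 * (3 + c0) * t2)"
        using \<open>t2 \<le> 5 * w\<close> t2 w assms by (intro divide_left_mono mult_left_mono mult_pos_pos) auto
      finally have "c * (real n / w) \<le> real n / (2 * (3 + c0) * t2)" .
      moreover have "0 \<le> c * (real n / w)" using c w by simp
      moreover have "w + ln (s / \<epsilon>) \<le> ln (S t2 / \<epsilon>)"
      proof -
        have "ln (s / \<epsilon>) \<le> ln (S t2 / \<epsilon> * exp (- w))"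
          using s \<epsilon> by (intro ln_mono) (auto simp: divide_right_mono)
        also have "\<dots> = ln (S t2 / \<epsilon>) - w"
          using ln_mult[of "S t2 / \<epsilon>" "exp (- w)"] Spos[OF t2] \<epsilon> by simp
        finally show ?thesis by simp
      qed
      ultimately have "ereal (c * (real n / w) * (w + ln (s / \<epsilon>))) \<le> ereal_of_enat (complexity c0 n \<epsilon> R L \<mu>)"
        using B by (intro scale)
      moreover have "c * (real n / w) * (w + ln (s / \<epsilon>)) = c * (real n + real n / w * ln (s / \<epsilon>))"
        using w by (simp add: field_simps)
      ultimately show "ereal (c * (real n + real n / w * ln (s / \<epsilon>)))
          \<le> ereal_of_enat (complexity c0 n \<epsilon> R L \<mu>)" by simp
    qed
  qed
qed

end
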